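(* For at most two objectives, i.e. for instances with $A\subseteq\mathbb{R}^d$ and $d\le 2$, Directed Coverage Pareto Pruning can be solved in time $O(|A|k+|A|\log|A|)$.
   Context: For $x,y\in\mathbb{R}^d$, $y$ dominates $x$ if $x_i\le y_i$ for all $i\in[d]$ and $x_j<y_j$ for some $j\in[d]$. An instance (with $d$ objectives) consists of a finite set $A\subseteq\mathbb{R}^d$ of alternatives, none of which is dominated by another element of $A$, and a positive integer $k$. Let $\|x-y\|_+=\sum_{i=1}^d\max(x_i-y_i,0)$. For $S\subseteq A$ put $I_{DC}(S,A)=\max_{a\in A}\min_{s\in S}\|a-s\|_+$. Directed Coverage Pareto Pruning: find $S\subseteq A$ with $|S|=k$ minimizing $I_{DC}(S,A)$. Running time counts arithmetic operations and comparisons on coordinates as unit cost. *)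

theory Defs
  imports Complex_Main "Jordan_Normal_Form.Matrix"
begin

section \<open>Directed Coverage Pareto Pruning\<close>

text \<open>Points with \<open>d\<close> real coordinates are the elements of \<^term>\<open>carrier_vec d :: real vec set\<close>.\<close>

definition dominates :: "real vec \<Rightarrow> real vec \<Rightarrow> bool" where
  "dominates y x \<longleftrightarrow>
     (\<forall>i < dim_vec x. x $ i \<le> y $ i) \<and> (\<exists>j < dim_vec x. x $ j < y $ j)"

definition pareto_instance :: "nat \<Rightarrow> real vec set \<Rightarrow> nat \<Rightarrow> bool" where
  "pareto_instance d A k \<longleftrightarrow>
     finite A \<and> A \<subseteq> carrier_vec d \<and> (\<forall>x\<in>A. \<forall>y\<in>A. \<not> dominates y x) \<and> 0 < k"

definition dplus :: "real vec \<Rightarrow> real vec \<Rightarrow> real" where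
  "dplus x y = (\<Sum>i < dim_vec x. max (x $ i - y $ i) 0)"

text \<open>Only meaningful for finite nonempty \<open>S\<close> and \<open>A\<close>.\<close>

definition I_DC :: "real vec set \<Rightarrow> real vec set \<Rightarrow> real" where
  "I_DC S A = Max ((\<lambda>a. Min ((\<lambda>s. dplus a s) ` S)) ` A)"

definition optimal_DC :: "real vec set \<Rightarrow> nat \<Rightarrow> real vec set \<Rightarrow> bool" where
  "optimal_DC A k S \<longleftrightarrow> is_arg_min (\<lambda>S. I_DC S A) (\<lambda>S. S \<subseteq> A \<and> card S = k) S"


section \<open>A unit-cost real RAM\<close>

text \<open>
  Programs are while-programs over finitely many named arrays: arrays of natural numbers,
  which are used for indices and counters, and arrays of reals. A scalar variable is cell 0
  of an array. Arithmetic on reals is exact. There is no rounding and no conversion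
  between reals and naturals, and the naturals only have addition, truncated subtraction and
  comparison, so that unbounded numbers cannot be abused to pack many values into one cell.
  Real constants in programs are integers. Every operation, memory access, constant, test and
  command costs one unit.
\<close>

datatype nexp =
    NConst nat
  | NLoad string nexp
  | NAdd nexp nexp
  | NSub nexp nexp

datatype rexp =
    RConst int
  | RLoad string nexp
  | RAdd rexp rexp
  | RSub rexp rexp
  | RMul rexp rexp
  | RDiv rexp rexp

datatype bexp =
    NLess nexp nexp
  | RLess rexp rexp
  | BNot bexp
  | BAnd bexp bexp

datatype com =
    Skip
  | NStore string nexp nexp
  | RStore string nexp rexp
  | Seq com com
  | Cond bexp com com
  | While bexp com

record store =
  nmem :: "string \<Rightarrow> nat \<Rightarrow> nat"
  rmem :: "string \<Rightarrow> nat \<Rightarrow> real"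

primrec nval :: "nexp \<Rightarrow> store \<Rightarrow> nat" where
  "nval (NConst c) s = c"
| "nval (NLoad a e) s = nmem s a (nval e s)"
| "nval (NAdd e f) s = nval e s + nval f s"
| "nval (NSub e f) s = nval e s - nval f s"

primrec rval :: "rexp \<Rightarrow> store \<Rightarrow> real" where
  "rval (RConst c) s = of_int c"
| "rval (RLoad a e) s = rmem s a (nval e s)"
| "rval (RAdd e f) s = rval e s + rval f s"
| "rval (RSub e f) s = rval e s - rval f s"
| "rval (RMul e f) s = rval e s * rval f s"
| "rval (RDiv e f) s = rval e s / rval f s"

primrec bval :: "bexp \<Rightarrow> store \<Rightarrow> bool" where
  "bval (NLess e f) s \<longleftrightarrow> nval e s < nval f s"
| "bval (RLess e f) s \<longleftrightarrow> rval e s < rval f s"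
| "bval (BNot b) s \<longleftrightarrow> \<not> bval b s"
| "bval (BAnd b c) s \<longleftrightarrow> bval b s \<and> bval c s"

primrec ncost :: "nexp \<Rightarrow> nat" where
  "ncost (NConst c) = 1"
| "ncost (NLoad a e) = ncost e + 1"
| "ncost (NAdd e f) = ncost e + ncost f + 1"
| "ncost (NSub e f) = ncost e + ncost f + 1"

primrec rcost :: "rexp \<Rightarrow> nat" where
  "rcost (RConst c) = 1"
| "rcost (RLoad a e) = ncost e + 1"
| "rcost (RAdd e f) = rcost e + rcost f + 1"
| "rcost (RSub e f) = rcost e + rcost f + 1"
| "rcost (RMul e f) = rcost e + rcost f + 1"
| "rcost (RDiv e f) = rcost e + rcost f + 1"

primrec bcost :: "bexp \<Rightarrow> nat" where
  "bcost (NLess e f) = ncost e + ncost f + 1"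
| "bcost (RLess e f) = rcost e + rcost f + 1"
| "bcost (BNot b) = bcost b + 1"
| "bcost (BAnd b c) = bcost b + bcost c + 1"

definition nstore :: "string \<Rightarrow> nat \<Rightarrow> nat \<Rightarrow> store \<Rightarrow> store" where
  "nstore a i v s = s\<lparr>nmem := (nmem s)(a := (nmem s a)(i := v))\<rparr>"

definition rstore :: "string \<Rightarrow> nat \<Rightarrow> real \<Rightarrow> store \<Rightarrow> store" where
  "rstore a i v s = s\<lparr>rmem := (rmem s)(a := (rmem s a)(i := v))\<rparr>"

text \<open>\<open>exec c s t s'\<close>: started in \<open>s\<close>, the program \<open>c\<close> halts in \<open>s'\<close> after exactly \<open>t\<close> steps.\<close>

inductive exec :: "com \<Rightarrow> store \<Rightarrow> nat \<Rightarrow> store \<Rightarrow> bool" where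
  exec_Skip: "exec Skip s 1 s"
| exec_NStore:
    "exec (NStore a e f) s (ncost e + ncost f + 1) (nstore a (nval e s) (nval f s) s)"
| exec_RStore:
    "exec (RStore a e f) s (ncost e + rcost f + 1) (rstore a (nval e s) (rval f s) s)"
| exec_Seq:
    "exec c1 s t1 s' \<Longrightarrow> exec c2 s' t2 s'' \<Longrightarrow> exec (Seq c1 c2) s (t1 + t2 + 1) s''"
| exec_CondT:
    "bval b s \<Longrightarrow> exec c1 s t s' \<Longrightarrow> exec (Cond b c1 c2) s (bcost b + t + 1) s'"
| exec_CondF:
    "\<not> bval b s \<Longrightarrow> exec c2 s t s' \<Longrightarrow> exec (Cond b c1 c2) s (bcost b + t + 1) s'"
| exec_WhileF:
    "\<not> bval b s \<Longrightarrow> exec (While b c) s (bcost b + 1) s"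
| exec_WhileT:
    "bval b s \<Longrightarrow> exec c s t1 s' \<Longrightarrow> exec (While b c) s' t2 s'' \<Longrightarrow>
     exec (While b c) s (bcost b + t1 + t2 + 1) s''"


section \<open>Input, output and solving the problem\<close>

text \<open>
  The alternatives are given as a list of points in arbitrary order, stored row by row in the
  real array \<open>X\<close>: coordinate \<open>j\<close> of point \<open>i\<close> is in cell \<open>i * d + j\<close>. All other cells are 0.
\<close>

definition input :: "nat \<Rightarrow> nat \<Rightarrow> real vec list \<Rightarrow> store" where
  "input d k xs =
     \<lparr>nmem = (\<lambda>a i. if a = ''n'' \<and> i = 0 then length xs
                    else if a = ''d'' \<and> i = 0 then d
                    else if a = ''k'' \<and> i = 0 then k
                    else 0),
      rmem = (\<lambda>a i. if a = ''X'' \<and> i < length xs * d then xs ! (i div d) $ (i mod d)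
                    else 0)\<rparr>"

definition read_output :: "store \<Rightarrow> nat list" where
  "read_output s = map (nmem s ''out'') [0..<nmem s ''len'' 0]"

text \<open>
  A solution is reported as the list of the positions of its elements in the input list,
  without repetitions. If \<open>k\<close> exceeds the number of alternatives there is no feasible
  solution, which is reported by the empty list.
\<close>

definition correct_output :: "real vec list \<Rightarrow> nat \<Rightarrow> nat list \<Rightarrow> bool" where
  "correct_output xs k out \<longleftrightarrow>
     (if k \<le> card (set xs)
      then distinct out \<and> set out \<subseteq> {..<length xs} \<and>
           optimal_DC (set xs) k ((\<lambda>i. xs ! i) ` set out)
      else out = [])"

text \<open>
  \<open>DC_solvable_in D T\<close>: one single program solves every instance whose number of objectives
  satisfies \<open>D\<close>, in time at most a constant times \<open>T |A| k\<close>. Instances without alternatives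
  are left out, as the maximum in \<^const>\<open>I_DC\<close> does not exist for them.
\<close>

definition DC_solvable_in :: "(nat \<Rightarrow> bool) \<Rightarrow> (nat \<Rightarrow> nat \<Rightarrow> real) \<Rightarrow> bool" where
  "DC_solvable_in D T \<longleftrightarrow>
     (\<exists>P. \<exists>C::real. \<forall>d A k xs.
        D d \<longrightarrow> pareto_instance d A k \<longrightarrow> A \<noteq> {} \<longrightarrow> distinct xs \<longrightarrow> set xs = A \<longrightarrow>
        (\<exists>t s. exec P (input d k xs) t s \<and> real t \<le> C * T (card A) k \<and>
               correct_output xs k (read_output s)))"

end

(*
  Sorted by the first coordinate x, the points of a planar antichain have increasing u = - second
  coordinate, and the directed distance from point i to point j is u j - u i if i <= j and
  x i - x j otherwise. So a center covers an interval, and the optimal radius for covering a prefix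
  with m centers is obtained from the one for m - 1 centers by two steps (from the first uncovered
  point to its center, and from the center to the last point it covers) that both have the form
  V i = min_{j <= i} max (U j) (w i - w j) with U and w nondecreasing. The minimizing j moves
  monotonically with i, so one step takes linear time, and k rounds yield the optimal radius r in
  time O(n k). Greedily jumping as far as r permits then finds at most k centers covering all
  points, which are padded to exactly k. Sorting is done by bottom-up merge sort. For d < 2 an
  antichain has at most one point.
*)
theory Submission
  imports Defs
begin

section \<open>Time bounds for programs\<close>

text \<open>The recurrence itself is only shown to bound every feasible radius from below. That its
  value is attained is not read off the recurrence but follows from the greedy run. The link is the
  invariant that, after c centers, the first uncovered index q is at least every prefix length b
  with \<open>best c b\<close> \<le> r. For c = k and b = n it forces q = n, so the cover cannot run
  out of centers. Hence no choices have to be stored with the table, and one row of it suffices: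
  only r is handed on to the greedy phase.

  Two details shape the recurrence. A prefix of length l has l as its first uncovered index, so one
  number serves both as argument of the table and as argument of \<open>u\<close>. And a nonempty
  prefix without centers has no finite radius; the machine has no infinity, so the range of u plus 1
  takes its place, which is safe because a single center at the right end already achieves the
  range.\<close>

definition run :: "com \<Rightarrow> store \<Rightarrow> nat \<Rightarrow> (store \<Rightarrow> bool) \<Rightarrow> bool" where
  "run c s T Q \<longleftrightarrow> (\<exists>t s'. exec c s t s' \<and> t \<le> T \<and> Q s')"

lemma run_mono:
  assumes "run c s T Q" "T \<le> T'" "\<And>s'. Q s' \<Longrightarrow> Q' s'"
  shows "run c s T' Q'"
  using assms unfolding run_def by (meson le_trans)

lemma run_Seq:
  assumes "run c1 s T1 (\<lambda>s'. run c2 s' T2 Q)"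
  shows "run (Seq c1 c2) s (T1 + T2 + 1) Q"
proof -
  from assms obtain t1 s' t2 s'' where "exec c1 s t1 s'" "t1 \<le> T1" "exec c2 s' t2 s''" "t2 \<le> T2" "Q s''"
    unfolding run_def by blast
  then show ?thesis
    unfolding run_def using exec_Seq by (intro exI[of _ "t1 + t2 + 1"] exI[of _ s'']) force
qed

lemma run_Seq':
  assumes "run c1 s T1 R" "\<And>s'. R s' \<Longrightarrow> run c2 s' T2 Q" "T1 + T2 + 1 \<le> T"
  shows "run (Seq c1 c2) s T Q"
  by (rule run_mono[OF run_Seq[OF run_mono[OF assms(1) order_refl assms(2)]] assms(3)])

lemma run_Cond:
  assumes "bval b s \<Longrightarrow> run c1 s T Q" "\<not> bval b s \<Longrightarrow> run c2 s T Q" "bcost b + T + 1 \<le> T'"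
  shows "run (Cond b c1 c2) s T' Q"
proof (cases "bval b s")
  case True
  then obtain t s' where "exec c1 s t s'" "t \<le> T" "Q s'" using assms(1) unfolding run_def by blast
  then show ?thesis unfolding run_def using exec_CondT[OF True] assms(3)
    by (intro exI[of _ "bcost b + t + 1"] exI[of _ s']) auto
next
  case False
  then obtain t s' where "exec c2 s t s'" "t \<le> T" "Q s'" using assms(2) unfolding run_def by blast
  then show ?thesis unfolding run_def using exec_CondF[OF False] assms(3)
    by (intro exI[of _ "bcost b + t + 1"] exI[of _ s']) auto
qed

text \<open>The first argument of the invariant is the time budget left for the remaining iterations.\<close>

lemma run_While:
  assumes "I T s"
    and "\<And>T s. I T s \<Longrightarrow> bval b s \<Longrightarrow>
      \<exists>U T'. run c s U (I T') \<and> bcost b + U + 1 + T' \<le> T"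
  shows "run (While b c) s (T + bcost b + 1) (\<lambda>s'. \<not> bval b s' \<and> (\<exists>T'. I T' s'))"
  using assms(1)
proof (induction T arbitrary: s rule: less_induct)
  case (less T)
  show ?case
  proof (cases "bval b s")
    case False
    then show ?thesis using less.prems exec_WhileF[OF False]
      unfolding run_def by (intro exI[of _ "bcost b + 1"] exI[of _ s]) auto
  next
    case True
    from assms(2)[OF less.prems True] obtain U T' where
      U: "run c s U (I T')" "bcost b + U + 1 + T' \<le> T" by blast
    then obtain t s' where s': "exec c s t s'" "t \<le> U" "I T' s'" unfolding run_def by blast
    \<comment> \<open>Every iteration costs at least one unit, so the budget itself is the
      termination measure.\<close>
    have "T' < T" using U by simp
    from less.IH[OF this s'(3)] obtain t2 s'' where
      s'': "exec (While b c) s' t2 s''" "t2 \<le> T' + bcost b + 1" "\<not> bval b s''" "\<exists>T'. I T' s''"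
      unfolding run_def by blast
    show ?thesis unfolding run_def
      using exec_WhileT[OF True s'(1) s''(1)] s'' U s'
      by (intro exI[of _ "bcost b + t + t2 + 1"] exI[of _ s'']) auto
  qed
qed

section \<open>Straight-line code, evaluated symbolically\<close>

primrec loop_free :: "com \<Rightarrow> bool" where
  "loop_free Skip \<longleftrightarrow> True"
| "loop_free (NStore a e f) \<longleftrightarrow> True"
| "loop_free (RStore a e f) \<longleftrightarrow> True"
| "loop_free (Seq c1 c2) \<longleftrightarrow> loop_free c1 \<and> loop_free c2"
| "loop_free (Cond b c1 c2) \<longleftrightarrow> loop_free c1 \<and> loop_free c2"
| "loop_free (While b c) \<longleftrightarrow> False"

text \<open>The clause for \<open>While\<close> is a placeholder: \<open>effect\<close> and
  \<open>ccost\<close> are only relied on for programs satisfying \<open>loop_free\<close>.\<close>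

primrec effect :: "com \<Rightarrow> store \<Rightarrow> store" where
  "effect Skip s = s"
| "effect (NStore a e f) s = nstore a (nval e s) (nval f s) s"
| "effect (RStore a e f) s = rstore a (nval e s) (rval f s) s"
| "effect (Seq c1 c2) s = effect c2 (effect c1 s)"
| "effect (Cond b c1 c2) s = (if bval b s then effect c1 s else effect c2 s)"
| "effect (While b c) s = s"

primrec ccost :: "com \<Rightarrow> nat" where
  "ccost Skip = 1"
| "ccost (NStore a e f) = ncost e + ncost f + 1"
| "ccost (RStore a e f) = ncost e + rcost f + 1"
| "ccost (Seq c1 c2) = ccost c1 + ccost c2 + 1"
| "ccost (Cond b c1 c2) = bcost b + max (ccost c1) (ccost c2) + 1"
| "ccost (While b c) = 0"

lemma run_loop_free':
  "loop_free c \<Longrightarrow> run c s (ccost c) (\<lambda>s'. s' = effect c s)"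
proof (induction c arbitrary: s)
  case (Seq c1 c2)
  then show ?case by (auto intro!: run_Seq'[where R = "\<lambda>s'. s' = effect c1 s"])
next
  case (Cond b c1 c2)
  show ?case
  proof (rule run_Cond[where T = "max (ccost c1) (ccost c2)"])
    show "run c1 s (max (ccost c1) (ccost c2)) (\<lambda>s'. s' = effect (Cond b c1 c2) s)" if "bval b s"
      by (rule run_mono[OF Cond.IH(1)]) (use Cond.prems that in auto)
    show "run c2 s (max (ccost c1) (ccost c2)) (\<lambda>s'. s' = effect (Cond b c1 c2) s)" if "\<not> bval b s"
      by (rule run_mono[OF Cond.IH(2)]) (use Cond.prems that in auto)
  qed simp
qed (use exec.intros(1,2,3) in \<open>fastforce simp: run_def\<close>)+

text \<open>Reduces straight-line code to rewriting: the simplifier computes the final store and the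
  cost, so loop bodies are verified without one rule application per command.\<close>

lemma run_loop_free:
  assumes "loop_free c" "Q (effect c s)" "ccost c \<le> T"
  shows "run c s T Q"
  using assms by (auto intro: run_mono[OF run_loop_free'])

lemma run_Seq_loop_free:
  assumes "loop_free c1" "run c2 (effect c1 s) T2 Q" "ccost c1 + T2 + 1 \<le> T"
  shows "run (Seq c1 c2) s T Q"
  by (rule run_Seq'[OF run_loop_free'[OF assms(1)]]) (use assms in auto)

lemma nmem_nstore [simp]: "nmem (nstore a i v s) b = (if a = b then (nmem s b)(i := v) else nmem s b)"
  and rmem_nstore [simp]: "rmem (nstore a i v s) = rmem s"
  and rmem_rstore [simp]: "rmem (rstore a i r s) b = (if a = b then (rmem s b)(i := r) else rmem s b)"
  and nmem_rstore [simp]: "nmem (rstore a i r s) = nmem s"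
  by (simp_all add: nstore_def rstore_def)

section \<open>Scalar variables, frame conditions and counting loops\<close>

abbreviation NVar :: "string \<Rightarrow> nexp" where "NVar v \<equiv> NLoad v (NConst 0)"

abbreviation NSet :: "string \<Rightarrow> nexp \<Rightarrow> com" where "NSet v \<equiv> NStore v (NConst 0)"

abbreviation NInc :: "string \<Rightarrow> com" where "NInc v \<equiv> NSet v (NAdd (NVar v) (NConst 1))"

text \<open>Frames go by array name, so a phase lists just the arrays of naturals it writes; the few
  changes of real arrays are stated separately.\<close>

definition nframe :: "string set \<Rightarrow> store \<Rightarrow> store \<Rightarrow> bool" where
  "nframe W s s' \<longleftrightarrow> (\<forall>a. a \<notin> W \<longrightarrow> nmem s' a = nmem s a)"

lemma nframe_refl [simp]: "nframe W s s"
  by (simp add: nframe_def)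

lemma nframe_trans: "nframe W s s' \<Longrightarrow> nframe W' s' s'' \<Longrightarrow> W \<union> W' \<subseteq> W'' \<Longrightarrow> nframe W'' s s''"
  unfolding nframe_def by (metis UnCI subsetD)

lemma nframe_nstore [simp]: "a \<in> W \<Longrightarrow> nframe W s (nstore a i v s') \<longleftrightarrow> nframe W s s'"
  by (auto simp: nframe_def)

lemma nframe_rstore [simp]: "nframe W s (rstore a i r s') \<longleftrightarrow> nframe W s s'"
  by (simp add: nframe_def)

definition For :: "string \<Rightarrow> string \<Rightarrow> com \<Rightarrow> com" where
  "For v w c = Seq (NSet v (NConst 0)) (While (NLess (NVar v) (NVar w)) (Seq c (NInc v)))"

text \<open>An iteration pays 5 for the test, 6 for the increment and one unit each for
  \<open>Seq\<close> and \<open>While\<close>, hence \<open>K + 13\<close>. The invariant is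
  demanded after the increment, so the body must leave the counter at \<open>i\<close> but need not
  preserve \<open>I\<close> itself.\<close>

lemma run_For:
  assumes "v \<noteq> w"
    and init: "I 0 (nstore v 0 0 s)"
    and frame: "\<And>i s. I i s \<Longrightarrow> i \<le> N \<Longrightarrow> nmem s v 0 = i \<and> nmem s w 0 = N"
    and step: "\<And>i s. i < N \<Longrightarrow> I i s \<Longrightarrow>
      run c s K (\<lambda>s'. nmem s' v 0 = i \<and> I (Suc i) (nstore v 0 (Suc i) s'))"
    and T: "(K + 13) * N + 13 \<le> T"
  shows "run (For v w c) s T (I N)"
proof -
  let ?b = "NLess (NVar v) (NVar w)"
  let ?J = "\<lambda>T s. \<exists>i\<le>N. T = (K + 13) * (N - i) \<and> I i s"
  have "run (While ?b (Seq c (NInc v))) (nstore v 0 0 s) ((K + 13) * N + bcost ?b + 1)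
    (\<lambda>s'. \<not> bval ?b s' \<and> (\<exists>T'. ?J T' s'))"
  proof (rule run_While)
    show "?J ((K + 13) * N) (nstore v 0 0 s)" using init by auto
    fix T s assume "?J T s" "bval ?b s"
    then obtain i where i: "i < N" "T = (K + 13) * (N - i)" "I i s"
      using frame by (metis bval.simps(1) le_less nval.simps(1,2))
    have "run (Seq c (NInc v)) s (K + 7) (?J ((K + 13) * (N - Suc i)))"
      by (rule run_Seq'[OF step[OF i(1) i(3)], where ?T2.0 = 6])
        (use i(1) in \<open>auto intro!: run_loop_free exI[of _ "Suc i"]\<close>)
    moreover have "(K + 13) * (N - i) = (K + 13) * (N - Suc i) + (K + 13)"
      using i(1) by (metis Suc_diff_Suc mult_Suc_right add.commute)
    then have "bcost ?b + (K + 7) + 1 + (K + 13) * (N - Suc i) \<le> T" using i(2) by simp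
    ultimately show "\<exists>U T'. run (Seq c (NInc v)) s U (?J T') \<and> bcost ?b + U + 1 + T' \<le> T"
      by blast
  qed
  then have W: "run (While ?b (Seq c (NInc v))) (nstore v 0 0 s) ((K + 13) * N + bcost ?b + 1) (I N)"
    using frame by (elim run_mono) (auto simp: le_less)
  show ?thesis unfolding For_def
  proof (rule run_Seq'[where R = "\<lambda>s'. s' = nstore v 0 0 s" and ?T1.0 = 3])
    show "run (NSet v (NConst 0)) s 3 (\<lambda>s'. s' = nstore v 0 0 s)"
      by (rule run_loop_free) simp_all
  qed (use W T in \<open>auto elim: run_mono\<close>)
qed

section \<open>The recurrence for the optimal radius\<close>

definition layer :: "(nat \<Rightarrow> real) \<Rightarrow> (nat \<Rightarrow> real) \<Rightarrow> nat \<Rightarrow> real" where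
  "layer w U i = Min ((\<lambda>j. max (U j) (w i - w j)) ` {..i})"

lemma layer_le: "j \<le> i \<Longrightarrow> layer w U i \<le> max (U j) (w i - w j)"
  unfolding layer_def by (rule Min_le) auto

lemma layer_attained: obtains j where "j \<le> i" "layer w U i = max (U j) (w i - w j)"
proof -
  have "layer w U i \<in> (\<lambda>j. max (U j) (w i - w j)) ` {..i}"
    unfolding layer_def by (rule Min_in) auto
  then show ?thesis using that by auto
qed

lemma layer_cong: "(\<And>j. j \<le> i \<Longrightarrow> w j = w' j) \<Longrightarrow> (\<And>j. j \<le> i \<Longrightarrow> U j = U' j) \<Longrightarrow> layer w U i = layer w' U' i"
  unfolding layer_def by (metis (mono_tags, lifting) atMost_iff image_cong order_refl)

lemma layer_nonneg:
  assumes "mono_on {..i} w" shows "0 \<le> layer w U i"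
proof -
  obtain j where "j \<le> i" "layer w U i = max (U j) (w i - w j)" by (rule layer_attained)
  moreover have "w j \<le> w i" using assms \<open>j \<le> i\<close> by (auto simp: mono_on_def)
  ultimately show ?thesis by auto
qed

text \<open>A minimizer j for \<open>i'\<close> also serves \<open>i\<close> if j \<le> i. Otherwise
  \<open>i\<close> itself serves, at cost max (U i) 0, which is no more because U i \<le> U j and w
  j \<le> w i'.\<close>

lemma layer_mono:
  assumes w: "mono_on {..<n} w" and U: "mono_on {..<n} U"
  shows "mono_on {..<n} (layer w U)"
proof (rule mono_onI)
  fix i i' assume i: "i \<in> {..<n}" "i' \<in> {..<n}" "i \<le> i'"
  obtain j where j: "j \<le> i'" "layer w U i' = max (U j) (w i' - w j)" by (rule layer_attained)
  show "layer w U i \<le> layer w U i'"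
  proof (cases "j \<le> i")
    case True
    have "w i \<le> w i'" using i w by (auto simp: mono_on_def)
    then show ?thesis using layer_le[OF True, of w U] j(2) by linarith
  next
    case False
    have "U i \<le> U j" "w j \<le> w i'" using i j False w U by (auto simp: mono_on_def)
    then show ?thesis using layer_le[OF order_refl, of w U i] j(2) by simp
  qed
qed

text \<open>In j, \<open>U j\<close> is nondecreasing and \<open>w i - w j\<close> nonincreasing, so
  the maximum is least where they cross, and two local comparisons certify the crossing:
  \<open>before\<close> makes \<open>w i - w l\<close> too large for every l < j,
  \<open>after\<close> makes \<open>U l\<close> too large for every l > j. As \<open>before\<close>
  survives an increase of \<open>w i\<close>, the minimizer never has to move back.\<close>

lemma layer_eqI:
  assumes w: "mono_on {..i} w" and U: "mono_on {..i} U" and j: "j \<le> i"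
    and before: "j = 0 \<or> U j \<le> w i - w (j - 1)" and after: "j = i \<or> w i - w j < U (Suc j)"
  shows "layer w U i = max (U j) (w i - w j)"
proof (rule antisym[OF layer_le[OF j]])
  obtain l where l: "l \<le> i" "layer w U i = max (U l) (w i - w l)" by (rule layer_attained)
  consider "l < j" | "l = j" | "j < l" by linarith
  then show "max (U j) (w i - w j) \<le> layer w U i"
  proof cases
    case 1
    have "w l \<le> w (j - 1)" by (rule mono_onD[OF w]) (use 1 j in auto)
    moreover have "w l \<le> w j" by (rule mono_onD[OF w]) (use 1 j in auto)
    ultimately show ?thesis using before 1 l by auto
  next
    case 2
    then show ?thesis using l by simp
  next
    case 3
    have "U j \<le> U l" "U (Suc j) \<le> U l" using 3 j l U by (auto simp: mono_on_def)
    then show ?thesis using after 3 l by auto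
  qed
qed

text \<open>The inner \<open>layer u\<close> places the last center at p: the earlier centers cover
  the prefix l, and the first index left to p is l, at distance u p - u l. The outer
  \<open>layer x\<close> chooses p for the last index to be covered, which is b - 1 for a prefix of
  length b.\<close>

primrec tab :: "(nat \<Rightarrow> real) \<Rightarrow> (nat \<Rightarrow> real) \<Rightarrow> real \<Rightarrow> nat \<Rightarrow> nat \<Rightarrow> real" where
  "tab x u M 0 b = (if b = 0 then 0 else M)"
| "tab x u M (Suc m) b = (if b = 0 then 0 else layer x (layer u (tab x u M m)) (b - 1))"

lemma tab_at_0 [simp]: "tab x u M m 0 = 0"
  by (cases m) auto

text \<open>Monotonicity is what the crossing argument needs of each row. The only special point is
  the value 0 of the empty prefix, below all others because layers are nonnegative.\<close>

lemma tab_mono: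
  assumes x: "mono_on {..<n} x" and u: "mono_on {..<n} u" and "0 \<le> M"
  shows "mono_on {..n} (tab x u M m)"
proof (induction m)
  case 0
  then show ?case using \<open>0 \<le> M\<close> by (auto simp: mono_on_def)
next
  case (Suc m)
  have "mono_on {..<n} (layer x (layer u (tab x u M m)))"
    by (intro layer_mono x u mono_on_subset[OF Suc]) auto
  moreover have "0 \<le> layer x (layer u (tab x u M m)) i" if "i < n" for i
    by (rule layer_nonneg, rule mono_on_subset[OF x]) (use that in auto)
  moreover have "b - 1 \<le> b' - 1" "b' - 1 < n" if "b \<le> b'" "0 < b'" "b' \<le> n" for b b' :: nat
    using that by auto
  ultimately show ?case by (fastforce simp: mono_on_def)
qed

text \<open>
  \<open>x\<close> lists the first coordinates and \<open>u\<close> the negated second coordinates of the alternatives,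
  in increasing order; \<open>gap i j\<close> is the directed distance from alternative \<open>i\<close> to
  alternative \<open>j\<close>.
\<close>

locale staircase =
  fixes n :: nat and x u :: "nat \<Rightarrow> real"
  assumes x_mono: "mono_on {..<n} x" and u_mono: "mono_on {..<n} u" and n_pos: "0 < n"
begin

definition gap :: "nat \<Rightarrow> nat \<Rightarrow> real" where
  "gap i j = (if i \<le> j then u j - u i else x i - x j)"

lemma x_le: "i \<le> j \<Longrightarrow> j < n \<Longrightarrow> x i \<le> x j"
  and u_le: "i \<le> j \<Longrightarrow> j < n \<Longrightarrow> u i \<le> u j"
  using x_mono u_mono by (auto simp: mono_on_def)

text \<open>The value given to nonempty prefixes without centers only has to exceed the optimal radius.\<close>

abbreviation "best \<equiv> tab x u (u (n - 1) - u 0 + 1)"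

text \<open>The rightmost center t is split off. Indices below l are covered by the other centers,
  which is the induction hypothesis for the prefix l. If l is not covered by them, t must cover it,
  which bounds u p - u l. If b - 1 lies to the right of t, all centers are to its left and t is the
  closest, which bounds x (b - 1) - x p.\<close>

lemma best_le_radius:
  assumes "finite Q" "Q \<subseteq> {..<n}" "card Q \<le> m" "b \<le> n" "0 \<le> r"
    and "\<And>i. i < b \<Longrightarrow> \<exists>q\<in>Q. gap i q \<le> r"
  shows "best m b \<le> r"
  using assms
proof (induction m arbitrary: Q b)
  case 0
  then show ?case by (cases "b = 0") auto
next
  case (Suc m)
  show ?case
  proof (cases "b = 0")
    case True
    then show ?thesis using \<open>0 \<le> r\<close> by simp
  next
    case False
    then have "Q \<noteq> {}" using Suc.prems(6)[of 0] by auto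
    define t where "t = Max Q"
    have t: "t \<in> Q" "\<And>q. q \<in> Q \<Longrightarrow> q \<le> t"
      using \<open>finite Q\<close> \<open>Q \<noteq> {}\<close> by (auto simp: t_def)
    \<comment> \<open>The center t may lie beyond the prefix. It is then pulled back to b - 1, which
      only shortens the distances from the indices to its left.\<close>
    define p where "p = min t (b - 1)"
    define covered where "covered i \<longleftrightarrow> (\<exists>q\<in>Q - {t}. gap i q \<le> r)" for i
    \<comment> \<open>The cap at p secures l \<le> p, as \<open>layer u\<close> requires; in the
      case l = p the distance u p - u l is just 0.\<close>
    define l where "l = (LEAST i. \<not> covered i \<or> i = p)"
    have l: "\<not> covered l \<or> l = p" unfolding l_def by (rule LeastI[of _ p]) simp
    have l_cov: "covered i" if "i < l" for i using not_less_Least[of i] that unfolding l_def by blast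
    have "l \<le> p" unfolding l_def by (rule Least_le) simp
    have "p < b" "p \<le> t" "t < n" using False Suc.prems t by (auto simp: p_def)
    have "best m l \<le> r"
      by (rule Suc.IH[of "Q - {t}"])
        (use Suc.prems t \<open>l \<le> p\<close> \<open>p < b\<close> l_cov in \<open>auto simp: covered_def\<close>)
    moreover have "u p - u l \<le> r"
    proof (cases "l = p")
      case False
      with l have "\<not> covered l" by simp
      moreover obtain q where "q \<in> Q" "gap l q \<le> r"
        using Suc.prems(6)[of l] \<open>l \<le> p\<close> \<open>p < b\<close> by auto
      ultimately have "gap l t \<le> r" by (auto simp: covered_def)
      then show ?thesis using \<open>l \<le> p\<close> \<open>p \<le> t\<close> \<open>t < n\<close> u_le[of p t] by (auto simp: gap_def)
    qed (use \<open>0 \<le> r\<close> in simp)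
    ultimately have F: "layer u (best m) p \<le> r"
      using layer_le[OF \<open>l \<le> p\<close>, of u "best m"] by linarith
    moreover have "x (b - 1) - x p \<le> r"
    proof (cases "p = b - 1")
      case False
      then have "p = t" "t < b - 1" by (auto simp: p_def)
      obtain q where q: "q \<in> Q" "gap (b - 1) q \<le> r"
        using Suc.prems(6)[of "b - 1"] \<open>p < b\<close> by auto
      then have "x (b - 1) - x q \<le> r" using t(2)[of q] \<open>t < b - 1\<close> by (auto simp: gap_def)
      then show ?thesis using x_le[of q t] t(2)[OF q(1)] \<open>p = t\<close> \<open>t < n\<close> by simp
    qed (use \<open>0 \<le> r\<close> in simp)
    moreover have "p \<le> b - 1" by (simp add: p_def)
    ultimately show ?thesis
      using layer_le[of p "b - 1" x "layer u (best m)"] False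
      unfolding tab.simps max_def by (smt (verit))
  qed
qed

lemma best_nonneg:
  assumes "b \<le> n" shows "0 \<le> best m b"
proof -
  have "best m 0 \<le> best m b"
    by (rule mono_onD[OF tab_mono[OF x_mono u_mono]]) (use assms u_le[of 0 "n - 1"] n_pos in auto)
  then show ?thesis by simp
qed

text \<open>Shows that the stand-in for infinity exceeds \<open>best k n\<close>, on which the start
  of the greedy invariant depends. The witness is the single center n - 1, which has every index to
  its left.\<close>

lemma best_le_range: "0 < k \<Longrightarrow> best k n \<le> u (n - 1) - u 0"
proof (rule best_le_radius[of "{n - 1}"])
  fix i assume "i < n"
  then show "\<exists>q\<in>{n - 1}. gap i q \<le> u (n - 1) - u 0"
    using u_le[of 0 i] by (auto simp: gap_def)
qed (use n_pos u_le[of 0 "n - 1"] in auto)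

text \<open>
  One round of the greedy cover goes from the first uncovered alternative \<open>q\<close> to the
  furthest admissible center \<open>p\<close>, and from there to the first alternative \<open>q'\<close> that
  \<open>p\<close> does not cover.
\<close>

lemma greedy_round:
  assumes inv: "\<And>b. b \<le> n \<Longrightarrow> best c b \<le> r \<Longrightarrow> b \<le> q" and "q \<le> p" "p < n"
    and p: "Suc p < n \<Longrightarrow> r < u (Suc p) - u q" and q': "q' < n \<Longrightarrow> r < x q' - x p"
    and b: "b \<le> n" "best (Suc c) b \<le> r"
  shows "b \<le> q'"
proof (rule ccontr)
  assume "\<not> b \<le> q'"
  then have "b \<noteq> 0" "q' < n" "q' \<le> b - 1" "b - 1 < n" using b by auto
  obtain p' where p': "p' \<le> b - 1" "layer x (layer u (best c)) (b - 1) = max (layer u (best c) p') (x (b - 1) - x p')"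
    by (rule layer_attained)
  then have "layer u (best c) p' \<le> r" "x (b - 1) - x p' \<le> r" using b \<open>b \<noteq> 0\<close> by auto
  obtain l where l: "l \<le> p'" "layer u (best c) p' = max (best c l) (u p' - u l)"
    by (rule layer_attained)
  then have "best c l \<le> r" "u p' - u l \<le> r" using \<open>layer u (best c) p' \<le> r\<close> by auto
  then have "l \<le> q" using inv[of l] l(1) p'(1) \<open>b - 1 < n\<close> by auto
  \<comment> \<open>If the center p' of the recurrence were beyond p, then u p' - u l would be at
    least u (Suc p) - u q, which exceeds r.\<close>
  have "p' \<le> p"
  proof (rule ccontr)
    assume "\<not> p' \<le> p"
    then have "Suc p \<le> p'" "p' < n" using p' \<open>b - 1 < n\<close> by auto
    then have "u (Suc p) \<le> u p'" "u l \<le> u q" using u_le \<open>l \<le> q\<close> \<open>q \<le> p\<close> \<open>p < n\<close> by auto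
    then show False using p \<open>Suc p \<le> p'\<close> \<open>p' < n\<close> \<open>u p' - u l \<le> r\<close> by auto
  qed
  then have "x p' \<le> x p" "x q' \<le> x (b - 1)"
    using x_le \<open>p < n\<close> \<open>q' \<le> b - 1\<close> \<open>b - 1 < n\<close> by auto
  then show False using q' \<open>q' < n\<close> \<open>x (b - 1) - x p' \<le> r\<close> by auto
qed

end

section \<open>Computing one step of the recurrence\<close>

definition layer_prog :: "string \<Rightarrow> string \<Rightarrow> string \<Rightarrow> nat \<Rightarrow> com" where
  "layer_prog U w V off =
    (let i = NVar ''i''; j = NVar ''j''; d = RSub (RLoad w i) (RLoad w j); tgt = NAdd i (NConst off) in
     Seq (NSet ''i'' (NConst 0)) (Seq (NSet ''j'' (NConst 0))
       (While (NLess i (NVar ''n''))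
         (Cond (BAnd (NLess j i) (BNot (RLess d (RLoad U (NAdd j (NConst 1))))))
            (NInc ''j'')
            (Seq (Cond (RLess (RLoad U j) d) (RStore V tgt d) (RStore V tgt (RLoad U j)))
                 (NInc ''i''))))))"

text \<open>The offset realizes the shift from index to prefix length in \<open>tab\<close>; the
  last clause protects cell 0, the value of the empty prefix.\<close>

definition layer_written :: "store \<Rightarrow> string \<Rightarrow> string \<Rightarrow> string \<Rightarrow> nat \<Rightarrow> nat \<Rightarrow> store \<Rightarrow> bool" where
  "layer_written s U w V off i s' \<longleftrightarrow>
     nframe {''i'', ''j''} s s' \<and> (\<forall>a. a \<noteq> V \<longrightarrow> rmem s' a = rmem s a) \<and>
     (\<forall>l<i. rmem s' V (l + off) = layer (rmem s w) (rmem s U) l) \<and>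
     (\<forall>l<off. rmem s' V l = rmem s V l)"

text \<open>Every pass through the loop advances exactly one of i and j, and j \<le> i \<le> n, so 2
  * n - i - j is a potential that pays for all passes, although a single i may need many of
  them.\<close>

lemma run_layer_prog:
  assumes n: "nmem s ''n'' 0 = n" and ne: "U \<noteq> V" "w \<noteq> V"
    and w: "mono_on {..<n} (rmem s w)" and U: "mono_on {..<n} (rmem s U)"
  shows "run (layer_prog U w V off) s (200 * n + 100) (layer_written s U w V off n)"
proof -
  \<comment> \<open>The comparison with \<open>j - 1\<close> is the premise \<open>before\<close> of
    \<open>layer_eqI\<close>. It is waived for i = n, where \<open>w\<close> is outside its monotone
    range.\<close>
  define J where "J T s' \<longleftrightarrow> (\<exists>i j. nmem s' ''i'' 0 = i \<and> nmem s' ''j'' 0 = j \<and> j \<le> i \<and> i \<le> n \<and>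
    (i = n \<or> j = 0 \<or> rmem s U j \<le> rmem s w i - rmem s w (j - 1)) \<and> T = 100 * (2 * n - i - j) \<and>
    layer_written s U w V off i s')" for T s'
  define d where "d = RSub (RLoad w (NVar ''i'')) (RLoad w (NVar ''j''))"
  define tgt where "tgt = NAdd (NVar ''i'') (NConst off)"
  define body where "body =
    Cond (BAnd (NLess (NVar ''j'') (NVar ''i'')) (BNot (RLess d (RLoad U (NAdd (NVar ''j'') (NConst 1))))))
      (NInc ''j'')
      (Seq (Cond (RLess (RLoad U (NVar ''j'')) d) (RStore V tgt d) (RStore V tgt (RLoad U (NVar ''j''))))
           (NInc ''i''))"
  define s1 where "s1 = nstore ''j'' 0 0 (nstore ''i'' 0 0 s)"
  have loop: "run (While (NLess (NVar ''i'') (NVar ''n'')) body) s1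
    (200 * n + bcost (NLess (NVar ''i'') (NVar ''n'')) + 1)
    (\<lambda>s'. \<not> bval (NLess (NVar ''i'') (NVar ''n'')) s' \<and> (\<exists>T. J T s'))"
  proof (rule run_While)
    show "J (200 * n) s1"
      unfolding J_def layer_written_def s1_def by auto
    fix T s' assume "J T s'" and b: "bval (NLess (NVar ''i'') (NVar ''n'')) s'"
    then obtain i j where ij: "nmem s' ''i'' 0 = i" "nmem s' ''j'' 0 = j" "j \<le> i" "i \<le> n"
      "i = n \<or> j = 0 \<or> rmem s U j \<le> rmem s w i - rmem s w (j - 1)" "T = 100 * (2 * n - i - j)"
      and L: "layer_written s U w V off i s'"
      unfolding J_def by blast
    have n': "nmem s' ''n'' 0 = n" using L n by (simp add: layer_written_def nframe_def)
    then have i: "i < n" using b ij by simp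
    have same: "rmem s' U = rmem s U" "rmem s' w = rmem s w" using L ne by (auto simp: layer_written_def)
    have mono: "mono_on {..i} (rmem s w)" "mono_on {..i} (rmem s U)"
      using w U i by (auto intro: mono_on_subset)
    have step: "J (T - 100) (effect body s')"
    proof (cases "j < i \<and> rmem s U (Suc j) \<le> rmem s w i - rmem s w j")
      case True
      then have "effect body s' = nstore ''j'' 0 (Suc j) s'"
        using ij by (simp add: body_def d_def same not_less)
      moreover have "layer_written s U w V off i (nstore ''j'' 0 (Suc j) s')"
        using L by (simp add: layer_written_def)
      ultimately show ?thesis
        unfolding J_def using True ij i by (auto intro!: exI[of _ i])
    next
      case False
      let ?v = "max (rmem s U j) (rmem s w i - rmem s w j)"
      have eff: "effect body s' = nstore ''i'' 0 (Suc i) (rstore V (i + off) ?v s')"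
        using ij False by (auto simp: body_def d_def tgt_def same not_less max_def)
      \<comment> \<open>The failed test of the program is precisely the premise
        \<open>after\<close>.\<close>
      have "layer (rmem s w) (rmem s U) i = ?v"
        by (rule layer_eqI[OF mono]) (use ij i False in auto)
      then have "layer_written s U w V off (Suc i) (effect body s')"
        using L ne unfolding eff layer_written_def by (auto simp: less_Suc_eq)
      moreover have "Suc i = n \<or> j = 0 \<or> rmem s U j \<le> rmem s w (Suc i) - rmem s w (j - 1)"
      proof -
        have "rmem s w i \<le> rmem s w (Suc i)" if "Suc i \<noteq> n"
          by (rule mono_onD[OF w]) (use that i in auto)
        then show ?thesis using ij(5) i by fastforce
      qed
      ultimately show ?thesis
        unfolding J_def using ij i by (auto simp: eff)
    qed
    have "run body s' 90 (J (T - 100))"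
      by (rule run_loop_free[where Q = "J (T - 100)", OF _ step]) (simp_all add: body_def d_def tgt_def)
    then show "\<exists>U T'. run body s' U (J T') \<and>
        bcost (NLess (NVar ''i'') (NVar ''n'')) + U + 1 + T' \<le> T"
      using ij i by (intro exI[of _ "T - 100"] exI[of _ "90::nat"] conjI) auto
  qed
  have "run (While (NLess (NVar ''i'') (NVar ''n'')) body) s1 (200 * n + 50)
    (layer_written s U w V off n)"
  proof (rule run_mono[OF loop])
    fix s' assume "\<not> bval (NLess (NVar ''i'') (NVar ''n'')) s' \<and> (\<exists>T. J T s')"
    then obtain i where "\<not> i < nmem s' ''n'' 0" "i \<le> n" "layer_written s U w V off i s'"
      unfolding J_def by auto
    moreover from this n have "nmem s' ''n'' 0 = n" by (simp add: layer_written_def nframe_def)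
    ultimately show "layer_written s U w V off n s'" by simp
  qed simp
  then have "run (Seq (NSet ''i'' (NConst 0)) (Seq (NSet ''j'' (NConst 0))
     (While (NLess (NVar ''i'') (NVar ''n'')) body))) s (200 * n + 100) (layer_written s U w V off n)"
    by (intro run_Seq_loop_free[where ?T2.0 = "200 * n + 70"]
        run_Seq_loop_free[where ?T2.0 = "200 * n + 50"]) (simp_all add: s1_def)
  then show ?thesis
    by (simp add: layer_prog_def Let_def body_def d_def tgt_def)
qed

section \<open>Merge sort\<close>

definition perm_on :: "nat \<Rightarrow> (nat \<Rightarrow> nat) \<Rightarrow> bool" where
  "perm_on n a \<longleftrightarrow> inj_on a {..<n} \<and> a ` {..<n} \<subseteq> {..<n}"

definition blocks_sorted :: "nat \<Rightarrow> nat \<Rightarrow> (nat \<Rightarrow> real) \<Rightarrow> bool" where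
  "blocks_sorted w n f \<longleftrightarrow>
     (\<forall>c p q. w dvd c \<longrightarrow> c \<le> p \<longrightarrow> p \<le> q \<longrightarrow> q < c + w \<longrightarrow> q < n \<longrightarrow> f p \<le> f q)"

lemma blocks_sortedD:
  "blocks_sorted w n f \<Longrightarrow> w dvd c \<Longrightarrow> c \<le> p \<Longrightarrow> p \<le> q \<Longrightarrow> q < c + w \<Longrightarrow> q < n \<Longrightarrow> f p \<le> f q"
  by (simp add: blocks_sorted_def)

text \<open>
  The blocks \<open>[l, l + w)\<close> and \<open>[l + w, l + 2 * w)\<close> of \<open>a\<close> are being merged into \<open>b\<close>;
  \<open>i\<close> and \<open>j\<close> point to their remaining parts and \<open>t\<close> is the next position to be written.
\<close>

definition merging ::
  "nat \<Rightarrow> nat \<Rightarrow> (nat \<Rightarrow> real) \<Rightarrow> (nat \<Rightarrow> nat) \<Rightarrow> nat \<Rightarrow> nat \<Rightarrow> nat \<Rightarrow> nat \<Rightarrow> (nat \<Rightarrow> nat) \<Rightarrow> bool" where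
  "merging n w key a l i j t b \<longleftrightarrow>
     l \<le> i \<and> i \<le> l + w \<and> l + w \<le> j \<and> j \<le> l + 2 * w \<and> (j \<le> n \<or> j = l + w) \<and>
     t + (l + w) = i + j \<and> t \<le> n \<and> 2 * w dvd l \<and>
     b ` {..<t} = a ` ({..<i} \<union> {l + w..<j}) \<and> inj_on b {..<t} \<and>
     blocks_sorted (2 * w) t (\<lambda>p. key (b p)) \<and>
     (\<forall>p q. l \<le> p \<longrightarrow> p < t \<longrightarrow> (i \<le> q \<and> q < l + w \<or> j \<le> q \<and> q < l + 2 * w) \<longrightarrow> q < n \<longrightarrow>
        key (b p) \<le> key (a q))"

text \<open>The least remaining key may be appended because the last clause of
  \<open>merging\<close> says that nothing written in the current block exceeds a remaining key;
  leastness in turn preserves that clause.\<close>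

lemma merging_put:
  assumes M: "merging n w key a l i j t b" and a: "inj_on a {..<n}" and "t < n" "t < l + 2 * w"
    and src: "(p = i \<and> i' = Suc i \<and> j' = j \<and> i < l + w) \<or> (p = j \<and> i' = i \<and> j' = Suc j \<and> j < l + 2 * w \<and> j < n)"
    and least: "\<And>q. i \<le> q \<and> q < l + w \<or> j \<le> q \<and> q < l + 2 * w \<Longrightarrow> q < n \<Longrightarrow> key (a p) \<le> key (a q)"
  shows "merging n w key a l i' j' (Suc t) (b(t := a p))"
proof -
  have bounds: "l \<le> i" "i \<le> l + w" "l + w \<le> j" "j \<le> l + 2 * w" "j \<le> n \<or> j = l + w" "t + (l + w) = i + j"
    and dvd: "2 * w dvd l" and img: "b ` {..<t} = a ` ({..<i} \<union> {l + w..<j})" and inj: "inj_on b {..<t}"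
    and sorted: "blocks_sorted (2 * w) t (\<lambda>p. key (b p))"
    and rest: "\<And>p q. l \<le> p \<Longrightarrow> p < t \<Longrightarrow> (i \<le> q \<and> q < l + w \<or> j \<le> q \<and> q < l + 2 * w) \<Longrightarrow> q < n \<Longrightarrow>
      key (b p) \<le> key (a q)"
    using M unfolding merging_def by blast+
  have "i \<le> t" "l \<le> t" using bounds by linarith+
  have "p < n" using src bounds \<open>i \<le> t\<close> \<open>t < n\<close> by linarith
  have p: "i \<le> p \<and> p < l + w \<or> j \<le> p \<and> p < l + 2 * w" using src by auto
  have "p \<notin> {..<i} \<union> {l + w..<j}" using p bounds by auto
  moreover have "{..<i} \<union> {l + w..<j} \<subseteq> {..<n}" using bounds \<open>i \<le> t\<close> \<open>t < n\<close> by auto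
  ultimately have new: "a p \<notin> b ` {..<t}"
    unfolding img using inj_on_image_mem_iff[OF a, of p] \<open>p < n\<close> by blast
  have upd: "b(t := a p) ` {..<Suc t} = insert (a p) (b ` {..<t})"
    by (auto simp: lessThan_Suc)
  have "insert p ({..<i} \<union> {l + w..<j}) = {..<i'} \<union> {l + w..<j'}"
    using src bounds by (auto simp: less_Suc_eq)
  then have img': "b(t := a p) ` {..<Suc t} = a ` ({..<i'} \<union> {l + w..<j'})"
    unfolding upd img by (metis image_insert)
  have inj': "inj_on (b(t := a p)) {..<Suc t}"
    using inj new by (force simp: lessThan_Suc inj_on_def)
  have sorted': "blocks_sorted (2 * w) (Suc t) (\<lambda>q. key ((b(t := a p)) q))"
    unfolding blocks_sorted_def
  proof (intro allI impI)
    fix c y z assume c: "2 * w dvd c" "c \<le> y" "y \<le> z" "z < c + 2 * w" "z < Suc t"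
    show "key ((b(t := a p)) y) \<le> key ((b(t := a p)) z)"
    proof (cases "z = t")
      case False
      then have "key (b y) \<le> key (b z)"
        using c by (intro blocks_sortedD[OF sorted]) auto
      then show ?thesis using False c by simp
    next
      case True
      \<comment> \<open>Both c and l are multiples of 2 * w, and t lies within 2 * w of each; hence
        they are the same block.\<close>
      obtain c' l' where eq: "c = 2 * w * c'" "l = 2 * w * l'" using c(1) dvd by (auto elim!: dvdE)
      have "2 * w * c' < 2 * w * Suc l'" "2 * w * l' < 2 * w * Suc c'"
        using c True eq \<open>l \<le> t\<close> \<open>t < l + 2 * w\<close> unfolding mult_Suc_right by linarith+
      then have "c' < Suc l'" "l' < Suc c'" by (simp_all only: mult_less_cancel1)
      then have "c' = l'" by simp
      then have "l \<le> y" using c eq by simp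
      then have "key (b y) \<le> key (a p)" if "y < t" by (rule rest[OF _ that p \<open>p < n\<close>])
      then show ?thesis using True c by (cases "y = t") auto
    qed
  qed
  have rest': "key ((b(t := a p)) y) \<le> key (a q)"
    if "l \<le> y" "y < Suc t" "i' \<le> q \<and> q < l + w \<or> j' \<le> q \<and> q < l + 2 * w" "q < n" for y q
  proof -
    have q: "i \<le> q \<and> q < l + w \<or> j \<le> q \<and> q < l + 2 * w" using that(3) src by linarith
    show ?thesis using least[OF q that(4)] rest[OF that(1) _ q that(4)] that(2) by (cases "y = t") auto
  qed
  have bounds': "l \<le> i'" "i' \<le> l + w" "l + w \<le> j'" "j' \<le> l + 2 * w" "j' \<le> n \<or> j' = l + w"
      "Suc t + (l + w) = i' + j'"
    using src bounds by linarith+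
  show ?thesis unfolding merging_def
    using bounds' dvd img' inj' sorted' rest' \<open>t < n\<close> by (intro conjI allI impI) (assumption | linarith | blast)+
qed

text \<open>The new right half starts at t + w, possibly beyond n. This is why
  \<open>merging\<close> admits j = l + w as an alternative to j \<le> n.\<close>

lemma merging_next_block:
  assumes M: "merging n w key a l i j t b" and "t = l + 2 * w"
  shows "merging n w key a t t (t + w) t b"
proof -
  have "i = l + w" "j = l + 2 * w" using assms by (auto simp: merging_def)
  then have "{..<i} \<union> {l + w..<j} = {..<t}" using \<open>t = l + 2 * w\<close> by auto
  then show ?thesis using assms by (auto simp: merging_def)
qed

lemma merging_step:
  assumes M: "merging n w key a l i j t b" and a: "inj_on a {..<n}" "blocks_sorted w n (\<lambda>p. key (a p))"
    and "t < n" "t < l + 2 * w"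
    and left: "left \<longleftrightarrow> i < l + w \<and> \<not> (j < l + 2 * w \<and> j < n \<and> key (a j) < key (a i))"
  shows "merging n w key a l (if left then Suc i else i) (if left then j else Suc j) (Suc t)
    (b(t := a (if left then i else j)))"
proof -
  note M' = M[unfolded merging_def]
  have "w dvd l" "w dvd l + w" using M' by (auto intro: dvd_mult_right)
  have I: "key (a i) \<le> key (a q)" if "i \<le> q" "q < l + w" "q < n" for q
    by (rule blocks_sortedD[OF a(2) \<open>w dvd l\<close>]) (use M' that in auto)
  have J: "key (a j) \<le> key (a q)" if "j \<le> q" "q < l + 2 * w" "q < n" for q
    by (rule blocks_sortedD[OF a(2) \<open>w dvd l + w\<close>]) (use M' that in auto)
  show ?thesis
  proof (cases left)
    case True
    with left have left': "i < l + w" "j < l + 2 * w \<Longrightarrow> j < n \<Longrightarrow> key (a i) \<le> key (a j)" by auto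
    have "key (a i) \<le> key (a q)" if "i \<le> q \<and> q < l + w \<or> j \<le> q \<and> q < l + 2 * w" "q < n" for q
      using that I[of q] J[of q] left' by fastforce
    then show ?thesis using merging_put[OF M a(1) \<open>t < n\<close> \<open>t < l + 2 * w\<close>, of i "Suc i" j] True left' by simp
  next
    case False
    \<comment> \<open>If the left half is exhausted, i = l + w turns the position equation into j =
      t, and the bounds on t carry over.\<close>
    have j: "j < l + 2 * w" "j < n" using False left M' \<open>t < n\<close> \<open>t < l + 2 * w\<close> by auto
    have "key (a j) \<le> key (a q)" if "i \<le> q \<and> q < l + w \<or> j \<le> q \<and> q < l + 2 * w" "q < n" for q
      using that I[of q] J[of q] left j False by fastforce
    then show ?thesis using merging_put[OF M a(1) \<open>t < n\<close> \<open>t < l + 2 * w\<close>, of j i "Suc j"] False j by simp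
  qed
qed

lemma merging_start: "0 < w \<Longrightarrow> merging n w key a 0 0 w 0 b"
  by (auto simp: merging_def blocks_sorted_def)

lemma merging_final:
  assumes "merging n w key a l i j n b" "perm_on n a"
  shows "perm_on n b" "blocks_sorted (2 * w) n (\<lambda>p. key (b p))"
proof -
  note M' = assms(1)[unfolded merging_def]
  have "i \<le> n" using M' by linarith
  then have "{..<i} \<union> {l + w..<j} \<subseteq> {..<n}" using M' by auto
  then show "perm_on n b" "blocks_sorted (2 * w) n (\<lambda>p. key (b p))"
    using M' assms(2) by (auto simp: perm_on_def image_subset_iff)
qed

section \<open>Bottom-up merge sort as a program\<close>

abbreviation key_of :: "string \<Rightarrow> rexp" where
  "key_of v \<equiv> RLoad ''X'' (NAdd (NLoad ''a'' (NVar v)) (NLoad ''a'' (NVar v)))"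

text \<open>The change to the next pair of blocks is part of the iteration that fills the last cell
  of the old pair, so a pass is a single counting loop with a straight-line body rather than a nest
  of loops.\<close>

definition merge_body :: com where
  "merge_body =
    (let n = NVar ''n''; l = NVar ''l''; i = NVar ''i''; j = NVar ''j''; t = NVar ''t''; w = NVar ''w'';
         t' = NAdd t (NConst 1) in
     Seq (Cond (BAnd (NLess i (NAdd l w))
                  (BNot (BAnd (NLess j (NAdd l (NAdd w w))) (BAnd (NLess j n) (RLess (key_of ''j'') (key_of ''i''))))))
            (Seq (NStore ''b'' t (NLoad ''a'' i)) (NInc ''i''))
            (Seq (NStore ''b'' t (NLoad ''a'' j)) (NInc ''j'')))
       (Cond (NLess t' (NAdd l (NAdd w w))) Skip
          (Seq (NSet ''l'' t') (Seq (NSet ''i'' t') (NSet ''j'' (NAdd t' w))))))"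

definition merge_pass :: com where
  "merge_pass =
    Seq (NSet ''l'' (NConst 0)) (Seq (NSet ''i'' (NConst 0)) (Seq (NSet ''j'' (NVar ''w''))
      (For ''t'' ''n'' merge_body)))"

text \<open>With two coordinates per row, row p starts at cell 2 * p; index expressions have no
  multiplication, hence the sum.\<close>

definition point_key :: "store \<Rightarrow> nat \<Rightarrow> real" where
  "point_key s p = rmem s ''X'' (p + p)"

lemma run_merge_pass:
  assumes n: "nmem s ''n'' 0 = n" and w: "nmem s ''w'' 0 = w" "0 < w"
    and a: "perm_on n (nmem s ''a'')" "blocks_sorted w n (\<lambda>p. point_key s (nmem s ''a'' p))"
  shows "run merge_pass s (150 * n + 50) (\<lambda>s'. rmem s' = rmem s \<and>
    nframe {''l'', ''i'', ''j'', ''t'', ''b''} s s' \<and> perm_on n (nmem s' ''b'') \<and>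
    blocks_sorted (2 * w) n (\<lambda>p. point_key s (nmem s' ''b'' p)))"
proof -
  define s1 where "s1 = nstore ''j'' 0 w (nstore ''i'' 0 0 (nstore ''l'' 0 0 s))"
  define I where "I t s' \<longleftrightarrow> nmem s' ''t'' 0 = t \<and> rmem s' = rmem s \<and>
    nframe {''l'', ''i'', ''j'', ''t'', ''b''} s s' \<and>
    t < nmem s' ''l'' 0 + 2 * w \<and>
    merging n w (point_key s) (nmem s ''a'') (nmem s' ''l'' 0) (nmem s' ''i'' 0) (nmem s' ''j'' 0) t
      (nmem s' ''b'')" for t s'
  have loop: "run (For ''t'' ''n'' merge_body) s1 (150 * n + 20) (I n)"
  proof (rule run_For[where K = 130])
    show "I 0 (nstore ''t'' 0 0 s1)"
      using w by (auto simp: I_def s1_def merging_start)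
    show "nmem s' ''t'' 0 = t \<and> nmem s' ''n'' 0 = n" if "I t s'" for t s'
      using that n by (auto simp: I_def nframe_def)
    fix t s' assume "t < n" and It: "I t s'"
    define i j l where ijl: "i = nmem s' ''i'' 0" "j = nmem s' ''j'' 0" "l = nmem s' ''l'' 0"
    have vars: "nmem s' ''t'' 0 = t" "nmem s' ''n'' 0 = n" "nmem s' ''w'' 0 = w" "nmem s' ''a'' = nmem s ''a''"
        "rmem s' = rmem s" and fr: "nframe {''l'', ''i'', ''j'', ''t'', ''b''} s s'"
      using It n w by (auto simp: I_def nframe_def)
    define left where "left \<longleftrightarrow> i < l + w \<and> \<not> (j < l + 2 * w \<and> j < n \<and>
      point_key s (nmem s ''a'' j) < point_key s (nmem s ''a'' i))"
    have M: "merging n w (point_key s) (nmem s ''a'') l i j t (nmem s' ''b'')" and "t < l + 2 * w"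
      using It by (auto simp: I_def ijl)
    define i' where "i' = (if left then Suc i else i)"
    define j' where "j' = (if left then j else Suc j)"
    define b' where "b' = (nmem s' ''b'')(t := nmem s ''a'' (if left then i else j))"
    have M': "merging n w (point_key s) (nmem s ''a'') l i' j' (Suc t) b'"
      unfolding i'_def j'_def b'_def
      by (rule merging_step[OF M _ a(2) \<open>t < n\<close> \<open>t < l + 2 * w\<close> left_def]) (use a in \<open>simp add: perm_on_def\<close>)
    let ?s = "effect merge_body s'"
    have bval: "left \<longleftrightarrow> bval (BAnd (NLess (NVar ''i'') (NAdd (NVar ''l'') (NVar ''w'')))
                  (BNot (BAnd (NLess (NVar ''j'') (NAdd (NVar ''l'') (NAdd (NVar ''w'') (NVar ''w''))))
                    (BAnd (NLess (NVar ''j'') (NVar ''n'')) (RLess (key_of ''j'') (key_of ''i'')))))) s'"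
      by (simp add: left_def point_key_def vars ijl mult_2)
    define s2 where "s2 = (if left then nstore ''i'' 0 i' (nstore ''b'' t (nmem s ''a'' i) s')
      else nstore ''j'' 0 j' (nstore ''b'' t (nmem s ''a'' j) s'))"
    have eff: "?s = (if Suc t < l + 2 * w then s2 else
        nstore ''j'' 0 (Suc t + w) (nstore ''i'' 0 (Suc t) (nstore ''l'' 0 (Suc t) s2)))"
      unfolding merge_body_def Let_def effect.simps(4) effect.simps(5)[of "BAnd _ _"] bval[symmetric]
      by (simp add: s2_def i'_def j'_def vars flip: ijl)
    have s2: "nmem s2 ''t'' 0 = t" "nmem s2 ''i'' 0 = i'" "nmem s2 ''j'' 0 = j'" "nmem s2 ''l'' 0 = l"
      "nmem s2 ''b'' = b'" "rmem s2 = rmem s" "nframe {''l'', ''i'', ''j'', ''t'', ''b''} s s2"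
      using vars fr ijl by (simp_all add: s2_def i'_def j'_def b'_def)
    have "nmem ?s ''t'' 0 = t \<and> I (Suc t) (nstore ''t'' 0 (Suc t) ?s)"
    proof (cases "Suc t < l + 2 * w")
      case True
      then show ?thesis using s2 M' by (simp add: I_def eff)
    next
      case False
      then have "Suc t = l + 2 * w" using \<open>t < l + 2 * w\<close> by simp
      from merging_next_block[OF M' this] show ?thesis
        using False s2 w by (simp add: I_def eff)
    qed
    then show "run merge_body s' 130 (\<lambda>s'. nmem s' ''t'' 0 = t \<and> I (Suc t) (nstore ''t'' 0 (Suc t) s'))"
      by (rule run_loop_free[rotated]) (simp_all add: merge_body_def Let_def)
  qed simp_all
  have "run merge_pass s (150 * n + 50) (I n)"
    unfolding merge_pass_def
    by (intro run_Seq_loop_free[where ?T2.0 = "150 * n + 40"]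
        run_Seq_loop_free[where ?T2.0 = "150 * n + 30"] run_Seq_loop_free[where ?T2.0 = "150 * n + 20"])
      (use loop w in \<open>simp_all add: s1_def\<close>)
  then show ?thesis
  proof (rule run_mono)
    fix s' assume "I n s'"
    then show "rmem s' = rmem s \<and> nframe {''l'', ''i'', ''j'', ''t'', ''b''} s s' \<and> perm_on n (nmem s' ''b'') \<and>
        blocks_sorted (2 * w) n (\<lambda>p. point_key s (nmem s' ''b'' p))"
      unfolding I_def using merging_final[OF _ a(1)] by blast
  qed simp
qed

definition copy_prog :: com where
  "copy_prog = For ''i'' ''n'' (NStore ''a'' (NVar ''i'') (NLoad ''b'' (NVar ''i'')))"

lemma run_copy_prog:
  assumes n: "nmem s ''n'' 0 = n"
  shows "run copy_prog s (30 * n + 20) (\<lambda>s'. rmem s' = rmem s \<and>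
    nframe {''i'', ''a''} s s' \<and> (\<forall>p<n. nmem s' ''a'' p = nmem s ''b'' p))"
  unfolding copy_prog_def
proof (rule run_mono[OF run_For[where K = 10 and N = n and I =
        "\<lambda>i s'. nmem s' ''i'' 0 = i \<and> rmem s' = rmem s \<and>
          nframe {''i'', ''a''} s s' \<and> (\<forall>p<i. nmem s' ''a'' p = nmem s ''b'' p)"]])
  fix i s' assume "nmem s' ''i'' 0 = i \<and> rmem s' = rmem s \<and>
          nframe {''i'', ''a''} s s' \<and> (\<forall>p<i. nmem s' ''a'' p = nmem s ''b'' p)"
  moreover from this have "nmem s' ''b'' = nmem s ''b''" by (simp add: nframe_def)
  ultimately show "run (NStore ''a'' (NVar ''i'') (NLoad ''b'' (NVar ''i''))) s' 10
    (\<lambda>s'. nmem s' ''i'' 0 = i \<and> nmem (nstore ''i'' 0 (Suc i) s') ''i'' 0 = Suc i \<and>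
      rmem (nstore ''i'' 0 (Suc i) s') = rmem s \<and> nframe {''i'', ''a''} s (nstore ''i'' 0 (Suc i) s') \<and>
      (\<forall>p<Suc i. nmem (nstore ''i'' 0 (Suc i) s') ''a'' p = nmem s ''b'' p))"
    by (intro run_loop_free) (auto simp: less_Suc_eq)
qed (use n in \<open>auto simp: nframe_def\<close>)

lemma perm_on_cong: "perm_on n a \<Longrightarrow> (\<And>p. p < n \<Longrightarrow> a' p = a p) \<Longrightarrow> perm_on n a'"
  unfolding perm_on_def inj_on_def by (simp add: image_subset_iff)

lemma blocks_sorted_cong:
  "blocks_sorted w n f \<Longrightarrow> (\<And>p. p < n \<Longrightarrow> f' p = f p) \<Longrightarrow> blocks_sorted w n f'"
  by (simp add: blocks_sorted_def)

definition sort_prog :: com where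
  "sort_prog = Seq (NSet ''w'' (NConst 1)) (While (NLess (NVar ''w'') (NVar ''n''))
     (Seq merge_pass (Seq copy_prog (NSet ''w'' (NAdd (NVar ''w'') (NVar ''w''))))))"

text \<open>After m passes the blocks have width 2 ^ m, and once n \<le> 2 ^ m the block at 0 is the
  whole array. The number of passes is bounded by a natural number \<open>L\<close> to keep
  logarithms out of the program analysis.\<close>

lemma run_sort_prog:
  assumes n: "nmem s ''n'' 0 = n" and L: "n \<le> 2 ^ L" and a: "perm_on n (nmem s ''a'')"
  shows "run sort_prog s (200 * (n + 1) * L + 20) (\<lambda>s'. rmem s' = rmem s \<and>
    nframe {''l'', ''i'', ''j'', ''t'', ''b'', ''a'', ''w''} s s' \<and> perm_on n (nmem s' ''a'') \<and>
    (\<forall>p q. p \<le> q \<longrightarrow> q < n \<longrightarrow> point_key s (nmem s' ''a'' p) \<le> point_key s (nmem s' ''a'' q)))"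
proof -
  let ?W = "{''l'', ''i'', ''j'', ''t'', ''b'', ''a'', ''w''}"
  let ?b = "NLess (NVar ''w'') (NVar ''n'')"
  let ?c = "Seq merge_pass (Seq copy_prog (NSet ''w'' (NAdd (NVar ''w'') (NVar ''w''))))"
  define J where "J m s' \<longleftrightarrow> nmem s' ''w'' 0 = 2 ^ m \<and> rmem s' = rmem s \<and>
    nframe ?W s s' \<and> perm_on n (nmem s' ''a'') \<and>
    blocks_sorted (2 ^ m) n (\<lambda>p. point_key s (nmem s' ''a'' p))" for m s'
  have "run (While ?b ?c) (nstore ''w'' 0 1 s) (200 * (n + 1) * L + bcost ?b + 1)
    (\<lambda>s'. \<not> bval ?b s' \<and> (\<exists>T. \<exists>m\<le>L. T = 200 * (n + 1) * (L - m) \<and> J m s'))"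
  proof (rule run_While)
    have "blocks_sorted (Suc 0) n f" for f :: "nat \<Rightarrow> real"
      unfolding blocks_sorted_def
    proof (intro allI impI)
      fix c p q :: nat assume "c \<le> p" "p \<le> q" "q < c + Suc 0"
      then have "p = q" by simp
      then show "f p \<le> f q" by simp
    qed
    then show "\<exists>m\<le>L. 200 * (n + 1) * L = 200 * (n + 1) * (L - m) \<and> J m (nstore ''w'' 0 1 s)"
      using a by (intro exI[of _ 0]) (simp add: J_def)
    fix T s' assume "\<exists>m\<le>L. T = 200 * (n + 1) * (L - m) \<and> J m s'" and b: "bval ?b s'"
    then obtain m where m: "m \<le> L" "T = 200 * (n + 1) * (L - m)" "J m s'" by blast
    have fr: "nframe ?W s s'" and r: "rmem s' = rmem s" and w: "nmem s' ''w'' 0 = 2 ^ m"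
      using m(3) by (auto simp: J_def)
    have n': "nmem s' ''n'' 0 = n" using fr n by (simp add: nframe_def)
    have "m < L"
    proof (rule ccontr)
      assume "\<not> m < L"
      then have "L = m" using m(1) by simp
      then show False using b w n' L by simp
    qed
    have key: "point_key s' = point_key s" by (simp add: point_key_def r fun_eq_iff)
    have c: "run ?c s' (180 * n + 100) (J (Suc m))"
    proof (rule run_Seq'[OF run_merge_pass[OF n' w]])
      fix s2 assume "rmem s2 = rmem s' \<and> nframe {''l'', ''i'', ''j'', ''t'', ''b''} s' s2 \<and>
        perm_on n (nmem s2 ''b'') \<and> blocks_sorted (2 * 2 ^ m) n (\<lambda>p. point_key s' (nmem s2 ''b'' p))"
      then have s2: "rmem s2 = rmem s" "nframe {''l'', ''i'', ''j'', ''t'', ''b''} s' s2"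
        "perm_on n (nmem s2 ''b'')" "blocks_sorted (2 ^ Suc m) n (\<lambda>p. point_key s (nmem s2 ''b'' p))"
        using r key by auto
      have n2: "nmem s2 ''n'' 0 = n" using s2 n' by (simp add: nframe_def)
      show "run (Seq copy_prog (NSet ''w'' (NAdd (NVar ''w'') (NVar ''w'')))) s2 (30 * n + 40) (J (Suc m))"
      proof (rule run_Seq'[OF run_copy_prog[OF n2], where ?T2.0 = 10])
        fix s3 assume "rmem s3 = rmem s2 \<and> nframe {''i'', ''a''} s2 s3 \<and>
          (\<forall>p<n. nmem s3 ''a'' p = nmem s2 ''b'' p)"
        then have s3: "rmem s3 = rmem s" "nframe {''i'', ''a''} s2 s3"
          "\<And>p. p < n \<Longrightarrow> nmem s3 ''a'' p = nmem s2 ''b'' p" using s2 by auto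
        have "perm_on n (nmem s3 ''a'')" by (rule perm_on_cong[OF s2(3) s3(3)])
        moreover have "blocks_sorted (2 ^ Suc m) n (\<lambda>p. point_key s (nmem s3 ''a'' p))"
          by (rule blocks_sorted_cong[OF s2(4)]) (simp add: s3)
        moreover have "nframe ?W s s3"
          by (rule nframe_trans[OF fr nframe_trans[OF s2(2) s3(2) order_refl]]) auto
        moreover have "nmem s3 ''w'' 0 = 2 ^ m" using w s2 s3 by (simp add: nframe_def)
        ultimately show "run (NSet ''w'' (NAdd (NVar ''w'') (NVar ''w''))) s3 10 (J (Suc m))"
          using s3 by (intro run_loop_free) (simp_all add: J_def)
      qed simp
    qed (use m in \<open>simp_all add: J_def key\<close>)
    have "200 * (n + 1) * (L - m) = 200 * (n + 1) * (L - Suc m) + 200 * (n + 1)"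
      using \<open>m < L\<close> by (metis Suc_diff_Suc mult_Suc_right add.commute)
    then have le: "bcost ?b + (180 * n + 100) + 1 + 200 * (n + 1) * (L - Suc m) \<le> T" using m(2) by simp
    have "run ?c s' (180 * n + 100)
      (\<lambda>s'. \<exists>m'\<le>L. 200 * (n + 1) * (L - Suc m) = 200 * (n + 1) * (L - m') \<and> J m' s')"
    proof (rule run_mono[OF c order_refl])
      fix s'' assume "J (Suc m) s''"
      then show "\<exists>m'\<le>L. 200 * (n + 1) * (L - Suc m) = 200 * (n + 1) * (L - m') \<and> J m' s''"
        using \<open>m < L\<close> by (intro exI[of _ "Suc m"]) (simp add: Suc_le_eq)
    qed
    with le show "\<exists>U T'. run ?c s' U (\<lambda>s'. \<exists>m\<le>L. T' = 200 * (n + 1) * (L - m) \<and> J m s') \<and>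
        bcost ?b + U + 1 + T' \<le> T"
      by blast
  qed
  then have loop: "run (While ?b ?c) (nstore ''w'' 0 1 s) (200 * (n + 1) * L + 6)
    (\<lambda>s'. rmem s' = rmem s \<and> nframe ?W s s' \<and> perm_on n (nmem s' ''a'') \<and>
      (\<forall>p q. p \<le> q \<longrightarrow> q < n \<longrightarrow> point_key s (nmem s' ''a'' p) \<le> point_key s (nmem s' ''a'' q)))"
  proof (rule run_mono)
    fix s' assume "\<not> bval ?b s' \<and> (\<exists>T. \<exists>m\<le>L. T = 200 * (n + 1) * (L - m) \<and> J m s')"
    then obtain m where m: "\<not> bval ?b s'" "J m s'" by blast
    have "nmem s' ''n'' 0 = n" "nmem s' ''w'' 0 = 2 ^ m" using m n by (simp_all add: J_def nframe_def)
    then have "n \<le> 2 ^ m" using m by simp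
    moreover have "blocks_sorted (2 ^ m) n (\<lambda>p. point_key s (nmem s' ''a'' p))" using m by (simp add: J_def)
    ultimately have "point_key s (nmem s' ''a'' p) \<le> point_key s (nmem s' ''a'' q)" if "p \<le> q" "q < n" for p q
      using blocks_sortedD[of "2 ^ m" n "\<lambda>p. point_key s (nmem s' ''a'' p)" 0 p q] that by simp
    then show "rmem s' = rmem s \<and> nframe ?W s s' \<and> perm_on n (nmem s' ''a'') \<and>
      (\<forall>p q. p \<le> q \<longrightarrow> q < n \<longrightarrow> point_key s (nmem s' ''a'' p) \<le> point_key s (nmem s' ''a'' q))"
      using m(2) by (simp add: J_def)
  qed simp
  show ?thesis unfolding sort_prog_def
    by (rule run_Seq_loop_free[where ?T2.0 = "200 * (n + 1) * L + 6"]) (use loop in simp_all)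
qed

section \<open>Computing the optimal radius\<close>

definition fill_prog :: com where
  "fill_prog = (let a = NLoad ''a'' (NVar ''i'') in For ''i'' ''n''
     (Seq (RStore ''x'' (NVar ''i'') (RLoad ''X'' (NAdd a a)))
       (RStore ''u'' (NVar ''i'') (RSub (RConst 0) (RLoad ''X'' (NAdd (NAdd a a) (NConst 1)))))))"

lemma run_fill_prog:
  assumes n: "nmem s ''n'' 0 = n"
  shows "run fill_prog s (60 * n + 20) (\<lambda>s'. nframe {''i''} s s' \<and>
    (\<forall>p<n. rmem s' ''x'' p = rmem s ''X'' (nmem s ''a'' p + nmem s ''a'' p) \<and>
      rmem s' ''u'' p = - rmem s ''X'' (nmem s ''a'' p + nmem s ''a'' p + 1)) \<and>
    (\<forall>a. a \<notin> {''x'', ''u''} \<longrightarrow> rmem s' a = rmem s a))"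
proof -
  define I where "I i s' \<longleftrightarrow> nmem s' ''i'' 0 = i \<and> nframe {''i''} s s' \<and>
    (\<forall>p<i. rmem s' ''x'' p = rmem s ''X'' (nmem s ''a'' p + nmem s ''a'' p) \<and>
      rmem s' ''u'' p = - rmem s ''X'' (nmem s ''a'' p + nmem s ''a'' p + 1)) \<and>
    (\<forall>a. a \<notin> {''x'', ''u''} \<longrightarrow> rmem s' a = rmem s a)" for i s'
  have "run fill_prog s (60 * n + 20) (I n)"
    unfolding fill_prog_def Let_def
  proof (rule run_For[where K = 40])
    fix i s' assume "I i s'"
    moreover from this have "nmem s' ''a'' = nmem s ''a''" by (simp add: I_def nframe_def)
    ultimately show "run (Seq (RStore ''x'' (NVar ''i'') (RLoad ''X'' (NAdd (NLoad ''a'' (NVar ''i'')) (NLoad ''a'' (NVar ''i'')))))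
       (RStore ''u'' (NVar ''i'') (RSub (RConst 0) (RLoad ''X'' (NAdd (NAdd (NLoad ''a'' (NVar ''i'')) (NLoad ''a'' (NVar ''i''))) (NConst 1))))))
       s' 40 (\<lambda>s'. nmem s' ''i'' 0 = i \<and> I (Suc i) (nstore ''i'' 0 (Suc i) s'))"
      by (intro run_loop_free) (auto simp: I_def less_Suc_eq)
  qed (use n in \<open>auto simp: I_def nframe_def\<close>)
  then show ?thesis by (rule run_mono) (auto simp: I_def)
qed

definition init_prog :: com where
  "init_prog = Seq (RStore ''G'' (NConst 0) (RConst 0)) (For ''i'' ''n''
     (RStore ''G'' (NAdd (NVar ''i'') (NConst 1))
       (RAdd (RSub (RLoad ''u'' (NSub (NVar ''n'') (NConst 1))) (RLoad ''u'' (NConst 0))) (RConst 1))))"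

lemma run_init_prog:
  assumes n: "nmem s ''n'' 0 = n"
  defines "M \<equiv> rmem s ''u'' (n - 1) - rmem s ''u'' 0 + 1"
  shows "run init_prog s (60 * n + 30) (\<lambda>s'. nframe {''i''} s s' \<and>
    (\<forall>b\<le>n. rmem s' ''G'' b = tab x u M 0 b) \<and> (\<forall>a. a \<noteq> ''G'' \<longrightarrow> rmem s' a = rmem s a))"
proof -
  define I where "I i s' \<longleftrightarrow> nmem s' ''i'' 0 = i \<and> nframe {''i''} s s' \<and>
    (\<forall>b\<le>i. rmem s' ''G'' b = tab x u M 0 b) \<and> (\<forall>a. a \<noteq> ''G'' \<longrightarrow> rmem s' a = rmem s a)" for i s'
  have "run init_prog s (60 * n + 30) (I n)"
    unfolding init_prog_def
  proof (rule run_Seq_loop_free[where ?T2.0 = "60 * n + 20"], simp, rule run_For[where K = 40])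
    fix i s' assume "I i s'"
    moreover from this have "nmem s' ''n'' 0 = n" using n by (simp add: I_def nframe_def)
    ultimately show "run (RStore ''G'' (NAdd (NVar ''i'') (NConst 1))
       (RAdd (RSub (RLoad ''u'' (NSub (NVar ''n'') (NConst 1))) (RLoad ''u'' (NConst 0))) (RConst 1)))
       s' 40 (\<lambda>s'. nmem s' ''i'' 0 = i \<and> I (Suc i) (nstore ''i'' 0 (Suc i) s'))"
      by (intro run_loop_free) (auto simp: I_def le_Suc_eq M_def)
  qed (use n in \<open>auto simp: I_def nframe_def\<close>)
  then show ?thesis by (rule run_mono) (auto simp: I_def)
qed

definition dp_prog :: com where
  "dp_prog = For ''m'' ''k'' (Seq (layer_prog ''G'' ''u'' ''F'' 0) (layer_prog ''F'' ''x'' ''G'' 1))"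

text \<open>\<open>G\<close> can be overwritten in place: the second step reads \<open>F\<close>
  only, and earlier rows are never consulted again.\<close>

lemma (in staircase) run_dp_prog:
  assumes n: "nmem s ''n'' 0 = n" and k: "nmem s ''k'' 0 = k"
    and xu: "rmem s ''x'' = x" "rmem s ''u'' = u"
    and G: "\<And>b. b \<le> n \<Longrightarrow> rmem s ''G'' b = best 0 b"
  shows "run dp_prog s ((400 * n + 220) * k + 20) (\<lambda>s'. nframe {''i'', ''j'', ''m''} s s' \<and>
    (\<forall>a. a \<notin> {''F'', ''G''} \<longrightarrow> rmem s' a = rmem s a) \<and> rmem s' ''G'' n = best k n)"
proof -
  define I where "I m s' \<longleftrightarrow> nmem s' ''m'' 0 = m \<and> nframe {''i'', ''j'', ''m''} s s' \<and>
    (\<forall>a. a \<notin> {''F'', ''G''} \<longrightarrow> rmem s' a = rmem s a) \<and> (\<forall>b\<le>n. rmem s' ''G'' b = best m b)" for m s'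
  have "run dp_prog s ((400 * n + 220) * k + 20) (I k)"
    unfolding dp_prog_def
  proof (rule run_For[where K = "400 * n + 203"])
    fix m s' assume "m < k" and Im: "I m s'"
    then have s': "rmem s' ''x'' = x" "rmem s' ''u'' = u" "nmem s' ''n'' 0 = n" "nmem s' ''m'' 0 = m"
        "nframe {''i'', ''j'', ''m''} s s'" "\<And>a. a \<notin> {''F'', ''G''} \<Longrightarrow> rmem s' a = rmem s a"
        "\<And>b. b \<le> n \<Longrightarrow> rmem s' ''G'' b = best m b"
      using xu n by (auto simp: I_def nframe_def)
    \<comment> \<open>Monotone rows are the precondition of the linear-time pass.\<close>
    have "mono_on {..n} (best m)"
      by (rule tab_mono[OF x_mono u_mono]) (use u_le[of 0 "n - 1"] n_pos in auto)
    then have best_mono: "mono_on {..<n} (best m)" by (rule mono_on_subset) auto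
    then have G_mono: "mono_on {..<n} (rmem s' ''G'')"
      using s'(7) by (simp add: mono_on_def)
    show "run (Seq (layer_prog ''G'' ''u'' ''F'' 0) (layer_prog ''F'' ''x'' ''G'' 1)) s' (400 * n + 203)
      (\<lambda>s'. nmem s' ''m'' 0 = m \<and> I (Suc m) (nstore ''m'' 0 (Suc m) s'))"
    proof (rule run_Seq'[OF run_layer_prog[OF s'(3)], where ?T2.0 = "200 * n + 100"])
      fix s2 assume "layer_written s' ''G'' ''u'' ''F'' 0 n s2"
      then have s2: "nframe {''i'', ''j''} s' s2" "\<And>a. a \<noteq> ''F'' \<Longrightarrow> rmem s2 a = rmem s' a"
          "\<And>l. l < n \<Longrightarrow> rmem s2 ''F'' l = layer u (rmem s' ''G'') l"
        using s' by (auto simp: layer_written_def)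
      have F: "rmem s2 ''F'' l = layer u (best m) l" if "l < n" for l
        unfolding s2(3)[OF that] using that s'(7) by (intro layer_cong) auto
      have F_mono: "mono_on {..<n} (rmem s2 ''F'')"
        using layer_mono[OF u_mono best_mono] F by (simp add: mono_on_def)
      have n2: "nmem s2 ''n'' 0 = n" using s2 s' by (simp add: nframe_def)
      show "run (layer_prog ''F'' ''x'' ''G'' 1) s2 (200 * n + 100)
        (\<lambda>s'. nmem s' ''m'' 0 = m \<and> I (Suc m) (nstore ''m'' 0 (Suc m) s'))"
      proof (rule run_mono[OF run_layer_prog[OF n2]])
        fix s3 assume "layer_written s2 ''F'' ''x'' ''G'' 1 n s3"
        then have s3: "nframe {''i'', ''j''} s2 s3" "\<And>a. a \<noteq> ''G'' \<Longrightarrow> rmem s3 a = rmem s2 a"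
            "\<And>l. l < n \<Longrightarrow> rmem s3 ''G'' (l + 1) = layer x (rmem s2 ''F'') l" "rmem s3 ''G'' 0 = rmem s2 ''G'' 0"
          using s2 s' by (auto simp: layer_written_def)
        have "rmem s3 ''G'' b = best (Suc m) b" if "b \<le> n" for b
        proof (cases b)
          case 0
          then show ?thesis using s3 s2 s'(7)[of 0] by simp
        next
          case (Suc l)
          then have "l < n" using that by simp
          have "layer x (rmem s2 ''F'') l = layer x (layer u (best m)) l"
            using F \<open>l < n\<close> by (intro layer_cong) auto
          then show ?thesis using s3(3)[OF \<open>l < n\<close>] Suc by simp
        qed
        moreover have "nmem s3 ''m'' 0 = m" using s'(4) s2 s3 by (simp add: nframe_def)
        moreover have "nframe {''i'', ''j'', ''m''} s s3"
          by (rule nframe_trans[OF s'(5) nframe_trans[OF s2(1) s3(1) order_refl]]) auto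
        ultimately show "nmem s3 ''m'' 0 = m \<and> I (Suc m) (nstore ''m'' 0 (Suc m) s3)"
          using s3(2) s2(2) s'(6) by (simp add: I_def)
      qed (use F_mono x_mono s2 s' in auto)
    qed (use G_mono u_mono s' in auto)
  qed (use n k G in \<open>auto simp: I_def nframe_def algebra_simps\<close>)
  then show ?thesis by (rule run_mono) (auto simp: I_def)
qed

section \<open>Greedy cover\<close>

text \<open>The cost is proportional to the distance travelled, so that scans of successive greedy
  rounds telescope. The final store is known exactly because only \<open>v\<close> is
  written.\<close>

lemma run_scan:
  assumes "i \<le> j" "nmem s v 0 = i"
    and "\<And>l. i \<le> l \<Longrightarrow> l < j \<Longrightarrow> bval b (nstore v 0 l s)" "\<not> bval b (nstore v 0 j s)"
  shows "run (While b (NInc v)) s ((bcost b + 7) * (j - i) + bcost b + 1) (\<lambda>s'. s' = nstore v 0 j s)"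
proof -
  have "run (While b (NInc v)) s ((bcost b + 7) * (j - i) + bcost b + 1)
    (\<lambda>s'. \<not> bval b s' \<and> (\<exists>T. \<exists>l. i \<le> l \<and> l \<le> j \<and> T = (bcost b + 7) * (j - l) \<and> s' = nstore v 0 l s))"
  proof (rule run_While)
    have "s = nstore v 0 i s"
      unfolding assms(2)[symmetric] by (simp add: nstore_def)
    then show "\<exists>l. i \<le> l \<and> l \<le> j \<and> (bcost b + 7) * (j - i) = (bcost b + 7) * (j - l) \<and> s = nstore v 0 l s"
      using assms(1) by blast
    fix T s' assume "\<exists>l. i \<le> l \<and> l \<le> j \<and> T = (bcost b + 7) * (j - l) \<and> s' = nstore v 0 l s" and b: "bval b s'"
    then obtain l where l: "i \<le> l" "l \<le> j" "T = (bcost b + 7) * (j - l)" "s' = nstore v 0 l s" by blast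
    then have "l < j" using b assms(4) by (metis le_less)
    then have T: "T = (bcost b + 7) * (j - Suc l) + (bcost b + 7)"
      using l(3) by (metis Suc_diff_Suc mult_Suc_right add.commute)
    have "nstore v 0 (Suc l) (nstore v 0 l s) = nstore v 0 (Suc l) s"
      by (simp add: nstore_def)
    then have "run (NInc v) s' 6 (\<lambda>s'. s' = nstore v 0 (Suc l) s)"
      using l by (intro run_loop_free) auto
    then have "run (NInc v) s' 6 (\<lambda>s'. \<exists>l'. i \<le> l' \<and> l' \<le> j \<and>
        (bcost b + 7) * (j - Suc l) = (bcost b + 7) * (j - l') \<and> s' = nstore v 0 l' s)"
      by (rule run_mono) (use l \<open>l < j\<close> in \<open>auto intro: exI[of _ "Suc l"]\<close>)
    with T show "\<exists>U T'. run (NInc v) s' U (\<lambda>s'. \<exists>l. i \<le> l \<and> l \<le> j \<and> T' = (bcost b + 7) * (j - l) \<and> s' = nstore v 0 l s) \<and>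
        bcost b + U + 1 + T' \<le> T"
      by (intro exI[of _ 6] exI[of _ "(bcost b + 7) * (j - Suc l)"]) simp
  qed
  then show ?thesis
    by (rule run_mono) (use assms(3) in \<open>auto simp: le_less\<close>)
qed

definition reach_test :: bexp where
  "reach_test = BAnd (NLess (NAdd (NVar ''p'') (NConst 1)) (NVar ''n''))
     (BNot (RLess (RLoad ''G'' (NVar ''n''))
       (RSub (RLoad ''u'' (NAdd (NVar ''p'') (NConst 1))) (RLoad ''u'' (NVar ''q'')))))"

definition cover_test :: bexp where
  "cover_test = BAnd (NLess (NVar ''q'') (NVar ''n''))
     (BNot (RLess (RLoad ''G'' (NVar ''n'')) (RSub (RLoad ''x'' (NVar ''q'')) (RLoad ''x'' (NVar ''p'')))))"

definition greedy_body :: com where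
  "greedy_body =
    Seq (NSet ''p'' (NVar ''q'')) (Seq (While reach_test (NInc ''p''))
      (Seq (Seq (NStore ''z'' (NVar ''p'') (NConst 1)) (Seq (NSet ''rem'' (NSub (NVar ''rem'') (NConst 1)))
          (NSet ''q'' (NAdd (NVar ''p'') (NConst 1)))))
        (While cover_test (NInc ''q''))))"

definition greedy_prog :: com where
  "greedy_prog = Seq (NSet ''rem'' (NVar ''k'')) (Seq (NSet ''q'' (NConst 0))
     (While (NLess (NVar ''q'') (NVar ''n'')) greedy_body))"

definition marked :: "nat \<Rightarrow> store \<Rightarrow> nat set" where
  "marked n s = {p. p < n \<and> 0 < nmem s ''z'' p}"

context staircase
begin

text \<open>The clause on \<open>best\<close> compares the greedy cover with the recurrence: no
  prefix that is feasible for the same number of centers extends beyond q.\<close>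

definition greedy_inv :: "store \<Rightarrow> nat \<Rightarrow> nat \<Rightarrow> store \<Rightarrow> bool" where
  "greedy_inv s k q s' \<longleftrightarrow> q \<le> n \<and> nmem s' ''q'' 0 = q \<and> nframe {''p'', ''q'', ''z'', ''rem''} s s' \<and>
     rmem s' = rmem s \<and> card (marked n s') \<le> k \<and> nmem s' ''rem'' 0 = k - card (marked n s') \<and>
     (\<forall>b\<le>n. best (card (marked n s')) b \<le> rmem s ''G'' n \<longrightarrow> b \<le> q) \<and> marked n s' \<subseteq> {..<q} \<and>
     (\<forall>i<q. \<exists>p\<in>marked n s'. gap i p \<le> rmem s ''G'' n)"

text \<open>Both scans move right, and the constant rest is paid for by the new center, which alone
  advances q by at least one. The time is thus charged to the alternatives passed, independently of
  k.\<close>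

lemma run_greedy_body:
  assumes n: "nmem s ''n'' 0 = n" and xu: "rmem s ''x'' = x" "rmem s ''u'' = u"
    and r: "rmem s ''G'' n = best k n"
    and inv: "greedy_inv s k q s'" and "q < n"
  shows "\<exists>q'>q. run greedy_body s' (180 * (q' - q)) (greedy_inv s k q')"
proof -
  define r where "r = rmem s ''G'' n"
  have "0 \<le> r" using best_nonneg[of n k] by (simp add: r_def assms(4))
  have s': "nmem s' ''n'' 0 = n" "rmem s' = rmem s" "nmem s' ''q'' 0 = q"
      "nframe {''p'', ''q'', ''z'', ''rem''} s s'"
    using inv n by (auto simp: greedy_inv_def nframe_def)
  define c where "c = card (marked n s')"
  have c: "c \<le> k" "nmem s' ''rem'' 0 = k - c" "\<And>b. b \<le> n \<Longrightarrow> best c b \<le> r \<Longrightarrow> b \<le> q"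
      "marked n s' \<subseteq> {..<q}" "\<And>i. i < q \<Longrightarrow> \<exists>p\<in>marked n s'. gap i p \<le> r"
    using inv by (auto simp: greedy_inv_def c_def r_def)
  \<comment> \<open>Here the number of centers is controlled: with k of them used, the prefix n
    would be within the radius and the invariant would give n \<le> q.\<close>
  have "c \<noteq> k" using c(3)[of n] \<open>q < n\<close> r by (auto simp: r_def)
  define s1 where "s1 = nstore ''p'' 0 q s'"
  have bp: "bval reach_test (nstore ''p'' 0 l s1) \<longleftrightarrow> Suc l < n \<and> u (Suc l) - u q \<le> r" for l
    using s' xu by (simp add: reach_test_def s1_def r_def not_less)
  define p where "p = (LEAST l. q \<le> l \<and> \<not> bval reach_test (nstore ''p'' 0 l s1))"
  have "q \<le> p \<and> \<not> bval reach_test (nstore ''p'' 0 p s1)"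
    unfolding p_def by (rule LeastI[of _ n]) (use \<open>q < n\<close> in \<open>simp add: bp\<close>)
  then have "q \<le> p" and p_end: "\<not> bval reach_test (nstore ''p'' 0 p s1)" by auto
  have p_test: "bval reach_test (nstore ''p'' 0 l s1)" if "q \<le> l" "l < p" for l
    using not_less_Least[of l] that unfolding p_def by blast
  have "p < n \<and> u p - u q \<le> r"
  proof (cases "p = q")
    case False
    then show ?thesis using p_test[of "p - 1"] \<open>q \<le> p\<close> by (simp add: bp)
  qed (use \<open>q < n\<close> \<open>0 \<le> r\<close> in simp)
  then have "p < n" and up: "u p - u q \<le> r" by auto
  define s2 where "s2 = nstore ''q'' 0 (Suc p) (nstore ''rem'' 0 (k - c - 1)
    (nstore ''z'' p 1 (nstore ''p'' 0 p s1)))"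
  have bq: "bval cover_test (nstore ''q'' 0 l s2) \<longleftrightarrow> l < n \<and> x l - x p \<le> r" for l
    using s' xu by (simp add: cover_test_def s1_def s2_def r_def not_less)
  define q' where "q' = (LEAST l. Suc p \<le> l \<and> \<not> bval cover_test (nstore ''q'' 0 l s2))"
  have "Suc p \<le> q' \<and> \<not> bval cover_test (nstore ''q'' 0 q' s2)"
    unfolding q'_def by (rule LeastI[of _ n]) (use \<open>p < n\<close> in \<open>simp add: bq\<close>)
  then have "Suc p \<le> q'" and q'_end: "\<not> bval cover_test (nstore ''q'' 0 q' s2)" by auto
  have q'_test: "bval cover_test (nstore ''q'' 0 l s2)" if "Suc p \<le> l" "l < q'" for l
    using not_less_Least[of l] that unfolding q'_def by blast
  have "q' \<le> n"
  proof (cases "q' = Suc p")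
    case False
    with \<open>Suc p \<le> q'\<close> have "Suc p \<le> q' - 1" "q' - 1 < q'" by auto
    from q'_test[OF this] have "q' - 1 < n" by (simp add: bq)
    then show ?thesis by linarith
  qed (use \<open>p < n\<close> in simp)
  define s3 where "s3 = nstore ''q'' 0 q' s2"
  have marked: "marked n s3 = insert p (marked n s')"
    using \<open>p < n\<close> by (auto simp: marked_def s3_def s2_def s1_def)
  have "p \<notin> marked n s'" "finite (marked n s')"
    using c(4) \<open>q \<le> p\<close> by (auto simp: marked_def)
  then have card: "card (marked n s3) = Suc c" by (simp add: marked c_def)
  have "b \<le> q'" if "b \<le> n" "best (Suc c) b \<le> r" for b
    by (rule greedy_round[OF c(3) \<open>q \<le> p\<close> \<open>p < n\<close> _ _ that])
      (use p_end q'_end in \<open>auto simp: bp bq\<close>)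
  moreover have "\<exists>y\<in>marked n s3. gap i y \<le> r" if "i < q'" for i
  proof (cases "i < q")
    case True
    then show ?thesis using c(5) by (auto simp: marked)
  next
    case False
    have "gap i p \<le> r"
    proof (cases "i \<le> p")
      case True
      then show ?thesis using up u_le[of q i] False \<open>p < n\<close> by (simp add: gap_def)
    next
      case False
      then show ?thesis using q'_test[of i] \<open>i < q'\<close> by (simp add: bq gap_def)
    qed
    then show ?thesis by (simp add: marked)
  qed
  moreover have "marked n s3 \<subseteq> {..<q'}"
    using c(4) \<open>q \<le> p\<close> \<open>Suc p \<le> q'\<close> by (auto simp: marked)
  moreover have "nmem s3 ''rem'' 0 = k - Suc c" "nmem s3 ''q'' 0 = q'" "rmem s3 = rmem s"
      "nframe {''p'', ''q'', ''z'', ''rem''} s s3"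
    using s' by (simp_all add: s3_def s2_def s1_def)
  ultimately have final: "greedy_inv s k q' s3"
    unfolding greedy_inv_def card using c(1) \<open>c \<noteq> k\<close> \<open>q' \<le> n\<close> by (simp add: r_def)
  have costs: "bcost reach_test + 7 = 29" "bcost cover_test + 7 = 25"
    by (simp_all add: reach_test_def cover_test_def)
  have "run (While cover_test (NInc ''q'')) s2 (25 * (q' - Suc p) + 40) (\<lambda>s'. s' = s3)"
    unfolding s3_def
    by (rule run_mono[OF run_scan[OF \<open>Suc p \<le> q'\<close> _ q'_test q'_end]])
      (use costs in \<open>simp_all add: s2_def\<close>)
  then have loop2: "run (Seq (Seq (NStore ''z'' (NVar ''p'') (NConst 1)) (Seq (NSet ''rem'' (NSub (NVar ''rem'') (NConst 1)))
          (NSet ''q'' (NAdd (NVar ''p'') (NConst 1)))))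
        (While cover_test (NInc ''q''))) (nstore ''p'' 0 p s1) (25 * (q' - Suc p) + 70) (\<lambda>s'. s' = s3)"
    by (intro run_Seq_loop_free[where ?T2.0 = "25 * (q' - Suc p) + 40"])
      (use c(2) in \<open>simp_all add: s1_def s2_def\<close>)
  have loop1: "run (While reach_test (NInc ''p'')) s1 (29 * (p - q) + 40) (\<lambda>s'. s' = nstore ''p'' 0 p s1)"
    by (rule run_mono[OF run_scan[OF \<open>q \<le> p\<close> _ p_test p_end]])
      (use costs in \<open>simp_all add: s1_def\<close>)
  have loops: "run (Seq (While reach_test (NInc ''p''))
      (Seq (Seq (NStore ''z'' (NVar ''p'') (NConst 1)) (Seq (NSet ''rem'' (NSub (NVar ''rem'') (NConst 1)))
          (NSet ''q'' (NAdd (NVar ''p'') (NConst 1)))))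
        (While cover_test (NInc ''q'')))) s1 (29 * (p - q) + 25 * (q' - Suc p) + 120) (\<lambda>s'. s' = s3)"
    by (rule run_Seq'[OF loop1, where ?T2.0 = "25 * (q' - Suc p) + 70"]) (use loop2 in simp_all)
  have "run greedy_body s' (29 * (p - q) + 25 * (q' - Suc p) + 140) (\<lambda>s'. s' = s3)"
    unfolding greedy_body_def
    by (rule run_Seq_loop_free[where ?T2.0 = "29 * (p - q) + 25 * (q' - Suc p) + 120"])
      (use s' loops in \<open>simp_all add: s1_def\<close>)
  then have "run greedy_body s' (180 * (q' - q)) (greedy_inv s k q')"
    by (rule run_mono) (use final \<open>q \<le> p\<close> \<open>Suc p \<le> q'\<close> in auto)
  then show ?thesis using \<open>q \<le> p\<close> \<open>Suc p \<le> q'\<close> by (intro exI[of _ q']) auto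
qed

lemma run_greedy_prog:
  assumes n: "nmem s ''n'' 0 = n" and k: "nmem s ''k'' 0 = k"
    and xu: "rmem s ''x'' = x" "rmem s ''u'' = u"
    and r: "rmem s ''G'' n = best k n" "best k n \<le> u (n - 1) - u 0"
    and z: "\<And>p. p < n \<Longrightarrow> nmem s ''z'' p = 0"
  shows "run greedy_prog s (200 * n + 40) (\<lambda>s'. nframe {''p'', ''q'', ''z'', ''rem''} s s' \<and>
    rmem s' = rmem s \<and> nmem s' ''rem'' 0 + card (marked n s') = k \<and>
    (\<forall>i<n. \<exists>p\<in>marked n s'. gap i p \<le> best k n))"
proof -
  let ?b = "NLess (NVar ''q'') (NVar ''n'')"
  let ?J = "\<lambda>T s'. \<exists>q. T = 200 * (n - q) \<and> greedy_inv s k q s'"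
  define s1 where "s1 = nstore ''q'' 0 0 (nstore ''rem'' 0 k s)"
  have loop: "run (While ?b greedy_body) s1 (200 * n + bcost ?b + 1) (\<lambda>s'. \<not> bval ?b s' \<and> (\<exists>T. ?J T s'))"
  proof (rule run_While)
    have "marked n s1 = {}" using z by (auto simp: marked_def s1_def)
    \<comment> \<open>For b > 0 the value \<open>best 0 b\<close> is u (n - 1) - u 0 + 1, larger
      than \<open>best k n\<close>, so only the empty prefix is within the radius.\<close>
    then have "greedy_inv s k 0 s1" using r by (auto simp: greedy_inv_def) (simp_all add: s1_def)
    then show "?J (200 * n) s1" by (intro exI[of _ 0]) simp
    fix T s' assume "?J T s'" and b: "bval ?b s'"
    then obtain q where q: "T = 200 * (n - q)" "greedy_inv s k q s'" by blast
    have "q < n" using q(2) b n by (auto simp: greedy_inv_def nframe_def)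
    from run_greedy_body[OF n xu r(1) q(2) this]
    obtain q' where q': "q < q'" and body: "run greedy_body s' (180 * (q' - q)) (greedy_inv s k q')" by blast
    have run: "run greedy_body s' (180 * (q' - q)) (\<lambda>s'. ?J (200 * (n - q')) s' \<and> q' \<le> n)"
      by (rule run_mono[OF body]) (auto simp: greedy_inv_def)
    \<comment> \<open>A \<open>run\<close> asserts that a final store exists; the invariant in that
      store supplies this bound.\<close>
    then have "q' \<le> n" by (auto simp: run_def)
    then have "bcost ?b + 180 * (q' - q) + 1 + 200 * (n - q') \<le> T" using q' q(1) by simp
    moreover have "run greedy_body s' (180 * (q' - q)) (?J (200 * (n - q')))"
      by (rule run_mono[OF run]) auto
    ultimately show "\<exists>U T'. run greedy_body s' U (?J T') \<and> bcost ?b + U + 1 + T' \<le> T"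
      by blast
  qed
  have "run (While ?b greedy_body) s1 (200 * n + 6) (greedy_inv s k n)"
  proof (rule run_mono[OF loop])
    fix s' assume "\<not> bval ?b s' \<and> (\<exists>T. ?J T s')"
    then obtain q where q: "\<not> bval ?b s'" "greedy_inv s k q s'" by blast
    moreover from this have "\<not> q < n" "q \<le> n" using n by (auto simp: greedy_inv_def nframe_def)
    ultimately show "greedy_inv s k n s'" by simp
  qed simp
  then have "run greedy_prog s (200 * n + 40) (greedy_inv s k n)"
    unfolding greedy_prog_def
    by (intro run_Seq_loop_free[where ?T2.0 = "200 * n + 30"] run_Seq_loop_free[where ?T2.0 = "200 * n + 6"])
      (use k in \<open>simp_all add: s1_def\<close>)
  then show ?thesis by (rule run_mono) (auto simp: greedy_inv_def r(1))
qed

end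

section \<open>Padding to k centers and writing the output\<close>

definition emit :: com where
  "emit = Seq (NStore ''out'' (NVar ''len'') (NLoad ''a'' (NVar ''i''))) (NInc ''len'')"

definition output_body :: com where
  "output_body = Cond (NLess (NConst 0) (NLoad ''z'' (NVar ''i''))) emit
    (Cond (NLess (NConst 0) (NVar ''rem'')) (Seq emit (NSet ''rem'' (NSub (NVar ''rem'') (NConst 1)))) Skip)"

definition output_prog :: com where
  "output_prog = Seq (NSet ''len'' (NConst 0)) (For ''i'' ''n'' output_body)"

text \<open>Unmarked ranks are emitted while the leftover budget lasts, which does no harm as
  further centers cannot increase a minimal distance. Ranks become input positions through
  \<open>a\<close>.\<close>

lemma run_output_prog:
  assumes n: "nmem s ''n'' 0 = n" and k: "nmem s ''rem'' 0 + card (marked n s) = k" "k \<le> n"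
  shows "run output_prog s (100 * n + 30) (\<lambda>s'. \<exists>ps. read_output s' = map (nmem s ''a'') ps \<and>
    distinct ps \<and> length ps = k \<and> marked n s \<subseteq> set ps \<and> set ps \<subseteq> {..<n})"
proof -
  \<comment> \<open>The last clause records that no rank is skipped before the leftover budget is
    spent.\<close>
  define I where "I i s' \<longleftrightarrow> nmem s' ''i'' 0 = i \<and> nframe {''i'', ''out'', ''len'', ''rem''} s s' \<and>
    (\<exists>ps. read_output s' = map (nmem s ''a'') ps \<and> distinct ps \<and> length ps = nmem s' ''len'' 0 \<and>
      set ps \<subseteq> {..<i} \<and> marked n s \<inter> {..<i} \<subseteq> set ps \<and>
      length ps + nmem s' ''rem'' 0 + card (marked n s - {..<i}) = k \<and>
      (0 < nmem s' ''rem'' 0 \<longrightarrow> length ps = i))" for i s'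
  have fin: "finite (marked n s)" by (simp add: marked_def)
  have "run (For ''i'' ''n'' output_body) (nstore ''len'' 0 0 s) (100 * n + 20) (I n)"
  proof (rule run_For[where K = 60])
    show "I 0 (nstore ''i'' 0 0 (nstore ''len'' 0 0 s))"
      using k by (auto simp: I_def read_output_def)
    show "nmem s' ''i'' 0 = i \<and> nmem s' ''n'' 0 = n" if "I i s'" for i s'
      using that n by (auto simp: I_def nframe_def)
    fix i s' assume "i < n" and "I i s'"
    then obtain ps where s': "nmem s' ''i'' 0 = i" "nframe {''i'', ''out'', ''len'', ''rem''} s s'"
      and ps: "read_output s' = map (nmem s ''a'') ps" "distinct ps" "length ps = nmem s' ''len'' 0"
        "set ps \<subseteq> {..<i}" "marked n s \<inter> {..<i} \<subseteq> set ps"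
        "length ps + nmem s' ''rem'' 0 + card (marked n s - {..<i}) = k"
        "0 < nmem s' ''rem'' 0 \<longrightarrow> length ps = i"
      unfolding I_def by (elim conjE exE) (rule that)
    have az: "nmem s' ''a'' = nmem s ''a''" "nmem s' ''z'' = nmem s ''z''"
      using s' by (auto simp: nframe_def)
    define s2 where "s2 = effect emit s'"
    have s2: "nmem s2 ''i'' 0 = i" "nmem s2 ''rem'' = nmem s' ''rem''" "nmem s2 ''len'' 0 = Suc (length ps)"
        "nframe {''i'', ''out'', ''len'', ''rem''} s s2"
        "read_output s2 = map (nmem s ''a'') (ps @ [i])"
      using s' ps(1,3) az by (simp_all add: s2_def emit_def read_output_def)
    have ro: "read_output (nstore v j y s) = read_output s" if "v \<notin> {''out'', ''len''}" for v j y s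
      using that by (simp add: read_output_def)
    have split: "marked n s - {..<i} = (if 0 < nmem s ''z'' i then insert i (marked n s - {..<Suc i})
        else marked n s - {..<Suc i})"
      using \<open>i < n\<close> by (auto simp: marked_def less_Suc_eq not_less le_less)
    have psi: "distinct (ps @ [i])" "set (ps @ [i]) \<subseteq> {..<Suc i}" "marked n s \<inter> {..<Suc i} \<subseteq> set (ps @ [i])"
      using ps(2,4,5) by (auto simp: less_Suc_eq)
    let ?t = "effect output_body s'"
    have "nmem ?t ''i'' 0 = i \<and> I (Suc i) (nstore ''i'' 0 (Suc i) ?t)"
    proof (cases "0 < nmem s ''z'' i")
      case True
      then have t: "?t = s2" by (simp add: output_body_def s' az s2_def)
      have "card (marked n s - {..<i}) = Suc (card (marked n s - {..<Suc i}))"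
        using True fin by (simp add: split)
      then show ?thesis
        unfolding t I_def using s2 psi ps(6,7) by (auto simp: ro intro!: exI[of _ "ps @ [i]"])
    next
      case False
      then have card: "card (marked n s - {..<i}) = card (marked n s - {..<Suc i})"
        by (simp add: split)
      show ?thesis
      proof (cases "0 < nmem s' ''rem'' 0")
        case True
        then have t: "?t = nstore ''rem'' 0 (nmem s' ''rem'' 0 - 1) s2"
          using False s2(2) by (simp add: output_body_def s' az s2_def)
        show ?thesis
          unfolding t I_def using s2 psi ps(6,7) True card
          by (auto simp: ro intro!: exI[of _ "ps @ [i]"])
      next
        case rem: False
        then have t: "?t = s'" using False by (simp add: output_body_def s' az)
        have "marked n s \<inter> {..<Suc i} \<subseteq> set ps"
          using False ps(5) by (auto simp: less_Suc_eq marked_def)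
        moreover have "set ps \<subseteq> {..<Suc i}" using ps(4) by auto
        ultimately show ?thesis
          unfolding t I_def using s' ps rem card by (auto simp: ro intro!: exI[of _ ps])
      qed
    qed
    then show "run output_body s' 60 (\<lambda>s'. nmem s' ''i'' 0 = i \<and> I (Suc i) (nstore ''i'' 0 (Suc i) s'))"
      by (rule run_loop_free[rotated]) (simp_all add: output_body_def emit_def)
  qed simp_all
  then have "run output_prog s (100 * n + 30) (I n)"
    unfolding output_prog_def by (intro run_Seq_loop_free[where ?T2.0 = "100 * n + 20"]) simp_all
  then show ?thesis
  proof (rule run_mono)
    fix s' assume "I n s'"
    then obtain ps where ps: "read_output s' = map (nmem s ''a'') ps" "distinct ps" "set ps \<subseteq> {..<n}"
        "marked n s \<inter> {..<n} \<subseteq> set ps" "length ps + nmem s' ''rem'' 0 + card (marked n s - {..<n}) = k"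
        "0 < nmem s' ''rem'' 0 \<longrightarrow> length ps = n"
      unfolding I_def by (elim conjE exE) (rule that)
    have sub: "marked n s \<subseteq> {..<n}" by (auto simp: marked_def)
    then have 0: "marked n s - {..<n} = {}" by blast
    \<comment> \<open>A positive leftover would mean that all n ranks were emitted, making k larger
      than n.\<close>
    have "length ps = k" using ps(5,6) k(2) unfolding 0 by fastforce
    then show "\<exists>ps. read_output s' = map (nmem s ''a'') ps \<and>
        distinct ps \<and> length ps = k \<and> marked n s \<subseteq> set ps \<and> set ps \<subseteq> {..<n}"
      using ps sub by (intro exI[of _ ps]) auto
  qed simp
qed

section \<open>Optimality\<close>

lemma dplus_2: "x \<in> carrier_vec 2 \<Longrightarrow> dplus x y = max (x $ 0 - y $ 0) 0 + max (x $ 1 - y $ 1) 0"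
  by (simp add: dplus_def carrier_vecD numeral_2_eq_2)

lemma antichain_2:
  assumes "pareto_instance 2 A k" "x \<in> A" "y \<in> A" "x $ 0 \<le> y $ 0"
  shows "y $ 1 \<le> x $ 1"
proof (rule ccontr)
  assume less: "\<not> y $ 1 \<le> x $ 1"
  have "dim_vec x = 2" using assms by (auto simp: pareto_instance_def)
  then have "dominates y x"
    using less assms(4) unfolding dominates_def by (auto simp: less_2_cases_iff intro!: exI[of _ 1])
  then show False using assms by (auto simp: pareto_instance_def)
qed

text \<open>With one coordinate, distinct points are comparable and one dominates the other; with
  none, there is only one vector.\<close>

lemma pareto_card_le_1:
  assumes "pareto_instance d A k" "d < 2"
  shows "card A \<le> 1"
proof -
  have "x = y" if "x \<in> A" "y \<in> A" for x y
  proof (rule ccontr)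
    assume "x \<noteq> y"
    have xy: "dim_vec x = d" "dim_vec y = d" "\<not> dominates x y" "\<not> dominates y x"
      using assms that by (auto simp: pareto_instance_def)
    then obtain i where "i < d" "x $ i \<noteq> y $ i" using \<open>x \<noteq> y\<close> by (auto simp: vec_eq_iff)
    moreover from this have "d = 1" "i = 0" using \<open>d < 2\<close> by auto
    ultimately show False using xy by (auto simp: dominates_def)
  qed
  then show ?thesis
    using assms(1) by (auto simp: pareto_instance_def card_le_Suc0_iff_eq)
qed

text \<open>A common threshold r certifies optimality, so \<open>I_DC\<close> never has to be
  evaluated.\<close>

lemma optimal_DC_I:
  assumes "finite A" "A \<noteq> {}" "0 < k" "S \<subseteq> A" "card S = k"
    and upper: "\<And>a. a \<in> A \<Longrightarrow> \<exists>s\<in>S. dplus a s \<le> r"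
    and lower: "\<And>S'. S' \<subseteq> A \<Longrightarrow> card S' = k \<Longrightarrow> r \<le> I_DC S' A"
  shows "optimal_DC A k S"
proof -
  have "finite S" using assms finite_subset by blast
  have "I_DC S A \<le> r"
    unfolding I_DC_def
  proof (rule Max.boundedI)
    fix v assume "v \<in> (\<lambda>a. Min ((\<lambda>s. dplus a s) ` S)) ` A"
    then obtain a where a: "a \<in> A" "v = Min ((\<lambda>s. dplus a s) ` S)" by blast
    obtain s where "s \<in> S" "dplus a s \<le> r" using upper[OF a(1)] by blast
    have "v \<le> dplus a s"
      unfolding a(2) by (rule Min_le) (use \<open>finite S\<close> \<open>s \<in> S\<close> in auto)
    then show "v \<le> r" using \<open>dplus a s \<le> r\<close> by simp
  qed (use assms in auto)
  then have "\<not> I_DC S' A < I_DC S A" if "S' \<subseteq> A" "card S' = k" for S'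
    using lower[OF that] by linarith
  then show ?thesis
    using assms(4,5) unfolding optimal_DC_def is_arg_min_def by blast
qed

lemma dplus_le_I_DC:
  assumes "finite A" "a \<in> A" "finite S" "S \<noteq> {}"
  obtains s where "s \<in> S" "dplus a s \<le> I_DC S A"
proof -
  have "Min ((\<lambda>s. dplus a s) ` S) \<in> (\<lambda>s. dplus a s) ` S"
    using assms by (intro Min_in) auto
  moreover have "Min ((\<lambda>s. dplus a s) ` S) \<le> I_DC S A"
    unfolding I_DC_def by (rule Max_ge) (use assms in auto)
  ultimately show ?thesis using that by force
qed

lemma dplus_nonneg: "0 \<le> dplus x y"
  by (simp add: dplus_def sum_nonneg)

text \<open>Ranks in the sorted order are separated from positions in the input: \<open>a\<close>
  maps the former to the latter. \<open>x\<close> and \<open>u\<close> are prescribed only below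
  \<open>n\<close> because they will be whole memory arrays.\<close>

locale sorted_points =
  fixes n :: nat and xs :: "real vec list" and a :: "nat \<Rightarrow> nat" and k :: nat and x u :: "nat \<Rightarrow> real"
  assumes inst: "pareto_instance 2 (set xs) k" and dist: "distinct xs" and n: "n = length xs" "0 < n"
    and perm: "perm_on n a" and x: "\<And>p. p < n \<Longrightarrow> x p = xs ! a p $ 0" and u: "\<And>p. p < n \<Longrightarrow> u p = - (xs ! a p $ 1)"
    and sorted: "\<And>p q. p \<le> q \<Longrightarrow> q < n \<Longrightarrow> xs ! a p $ 0 \<le> xs ! a q $ 0"
begin

lemma a_less: "p < n \<Longrightarrow> a p < n"
  using perm by (auto simp: perm_on_def)

lemma point_in: "p < n \<Longrightarrow> xs ! a p \<in> set xs"
  using a_less n by auto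

lemma second_antimono: "p \<le> q \<Longrightarrow> q < n \<Longrightarrow> xs ! a q $ 1 \<le> xs ! a p $ 1"
  using antichain_2[OF inst point_in point_in sorted] by simp

sublocale staircase n x u
  by unfold_locales (use n sorted second_antimono in \<open>auto simp: mono_on_def x u\<close>)

text \<open>Along the sorted antichain one coordinate rises while the other falls, so one of the two
  positive parts vanishes and the other is \<open>gap\<close>.\<close>

lemma dplus_points: "p < n \<Longrightarrow> q < n \<Longrightarrow> dplus (xs ! a p) (xs ! a q) = gap p q"
proof -
  assume pq: "p < n" "q < n"
  have "xs ! a p \<in> carrier_vec 2" using point_in[OF pq(1)] inst by (auto simp: pareto_instance_def)
  moreover have "xs ! a q $ 1 \<le> xs ! a p $ 1 \<and> xs ! a p $ 0 \<le> xs ! a q $ 0" if "p \<le> q"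
    using that pq sorted second_antimono by blast
  moreover have "xs ! a p $ 1 \<le> xs ! a q $ 1 \<and> xs ! a q $ 0 \<le> xs ! a p $ 0" if "\<not> p \<le> q"
    using that pq sorted second_antimono by simp
  ultimately show ?thesis using pq by (cases "p \<le> q") (auto simp: dplus_2 gap_def x u)
qed

text \<open>\<open>perm_on\<close> records injectivity only; surjectivity comes from
  finiteness.\<close>

lemma point_index:
  assumes "y \<in> set xs" obtains p where "p < n" "y = xs ! a p"
proof -
  have a_image: "a ` {..<n} = {..<n}"
    by (rule endo_inj_surj) (use perm in \<open>simp_all add: perm_on_def\<close>)
  obtain i where "i < n" and y: "y = xs ! i" using assms n by (auto simp: in_set_conv_nth)
  then have "i \<in> a ` {..<n}" unfolding a_image by simp
  then obtain p where "p < n" "i = a p" by auto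
  then show thesis using y by (intro that) simp_all
qed

lemma inj_point: "inj_on (\<lambda>p. xs ! a p) {..<n}"
proof (rule inj_onI)
  fix p q assume pq: "p \<in> {..<n}" "q \<in> {..<n}" "xs ! a p = xs ! a q"
  then have "a p = a q" using a_less dist n by (simp add: nth_eq_iff_index_eq)
  then show "p = q" using perm pq by (simp add: perm_on_def inj_on_def)
qed

text \<open>A competitor \<open>S\<close> is replaced by the set of ranks of its points, which is no
  larger by injectivity and covers all ranks within \<open>I_DC S\<close>.\<close>

lemma best_le_I_DC:
  assumes "S \<subseteq> set xs" "card S = k"
  shows "best k n \<le> I_DC S (set xs)"
proof -
  define Q where "Q = {p \<in> {..<n}. xs ! a p \<in> S}"
  have S: "finite S" "S \<noteq> {}"
    using finite_subset[OF assms(1)] assms(2) inst by (auto simp: pareto_instance_def)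
  have "card Q = card ((\<lambda>p. xs ! a p) ` Q)"
    by (rule card_image[symmetric], rule inj_on_subset[OF inj_point]) (auto simp: Q_def)
  also have "\<dots> \<le> card S" by (rule card_mono) (auto simp: Q_def S)
  finally have "card Q \<le> k" using assms by simp
  have cover: "\<exists>q\<in>Q. gap i q \<le> I_DC S (set xs)" if i: "i < n" for i
  proof -
    obtain s where s: "s \<in> S" "dplus (xs ! a i) s \<le> I_DC S (set xs)"
      by (rule dplus_le_I_DC[OF List.finite_set point_in[OF i] S])
    then have "s \<in> set xs" using assms by blast
    then obtain q where "q < n" "s = xs ! a q" by (rule point_index)
    with s i show ?thesis
      by (intro bexI[of _ q]) (simp_all add: Q_def dplus_points)
  qed
  obtain s where "dplus (xs ! a 0) s \<le> I_DC S (set xs)"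
    by (rule dplus_le_I_DC[OF List.finite_set point_in[OF n(2)] S])
  then have "0 \<le> I_DC S (set xs)" using dplus_nonneg[of "xs ! a 0" s] by linarith
  moreover have "finite Q" "Q \<subseteq> {..<n}" by (auto simp: Q_def)
  ultimately show ?thesis
    using best_le_radius[OF _ _ \<open>card Q \<le> k\<close> order_refl _ cover] by blast
qed

lemma correct_output_map:
  assumes "distinct ps" "length ps = k" "set ps \<subseteq> {..<n}" "k \<le> n"
    and "\<And>i. i < n \<Longrightarrow> \<exists>p\<in>set ps. gap i p \<le> best k n"
  shows "correct_output xs k (map a ps)"
proof -
  let ?S = "(\<lambda>i. xs ! i) ` set (map a ps)"
  have S: "?S = (\<lambda>p. xs ! a p) ` set ps" by auto
  have "card ?S = k"
    unfolding S using assms by (subst card_image) (auto intro: inj_on_subset[OF inj_point] simp: distinct_card)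
  moreover have "?S \<subseteq> set xs" using assms point_in by auto
  moreover have "\<exists>s\<in>?S. dplus y s \<le> best k n" if "y \<in> set xs" for y
  proof -
    from that obtain i where i: "i < n" "y = xs ! a i" by (rule point_index)
    then obtain p where "p \<in> set ps" "gap i p \<le> best k n" using assms(5) by blast
    then show ?thesis using i assms(3) by (intro bexI[of _ "xs ! a p"]) (auto simp: dplus_points)
  qed
  ultimately have "optimal_DC (set xs) k ?S"
    using inst n best_le_I_DC by (intro optimal_DC_I[of _ _ _ "best k n"]) (auto simp: pareto_instance_def)
  moreover have "distinct (map a ps)"
    using assms perm by (auto simp: distinct_map perm_on_def intro: inj_on_subset)
  moreover have "set (map a ps) \<subseteq> {..<length xs}" using assms(3) a_less n by auto
  moreover have "k \<le> card (set xs)" using assms n distinct_card[OF dist] by simp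
  ultimately show ?thesis by (simp add: correct_output_def)
qed

end

section \<open>The complete program and its running time\<close>

definition id_prog :: com where
  "id_prog = For ''i'' ''n'' (NStore ''a'' (NVar ''i'') (NVar ''i''))"

lemma run_id_prog:
  assumes n: "nmem s ''n'' 0 = n"
  shows "run id_prog s (30 * n + 20) (\<lambda>s'. rmem s' = rmem s \<and>
    nframe {''i'', ''a''} s s' \<and> perm_on n (nmem s' ''a''))"
proof -
  define I where "I i s' \<longleftrightarrow> nmem s' ''i'' 0 = i \<and> rmem s' = rmem s \<and>
    nframe {''i'', ''a''} s s' \<and> (\<forall>p<i. nmem s' ''a'' p = p)" for i s'
  have "run id_prog s (30 * n + 20) (I n)"
    unfolding id_prog_def
  proof (rule run_For[where K = 10])
    show "run (NStore ''a'' (NVar ''i'') (NVar ''i'')) s' 10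
      (\<lambda>s'. nmem s' ''i'' 0 = i \<and> I (Suc i) (nstore ''i'' 0 (Suc i) s'))" if "I i s'" for i s'
      using that by (intro run_loop_free) (auto simp: I_def less_Suc_eq)
  qed (use n in \<open>auto simp: I_def nframe_def\<close>)
  then show ?thesis by (rule run_mono) (auto simp: I_def perm_on_def inj_on_def)
qed

definition plane_prog :: com where
  "plane_prog = Seq id_prog (Seq sort_prog (Seq fill_prog (Seq init_prog
     (Seq dp_prog (Seq greedy_prog output_prog)))))"

lemma run_plane_prog:
  assumes inst: "pareto_instance 2 (set xs) k" and dist: "distinct xs"
    and n: "n = length xs" "0 < n" and k: "k \<le> n" and L: "n \<le> 2 ^ L"
  shows "run plane_prog (input 2 k xs) (400 * n * L + 620 * n * k + 450 * n + 300)
    (\<lambda>s. correct_output xs k (read_output s))"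
proof -
  define s0 where "s0 = input 2 k xs"
  have s0: "nmem s0 ''n'' 0 = n" "nmem s0 ''k'' 0 = k" "nmem s0 ''z'' = (\<lambda>_. 0)"
      "\<And>i. i < n \<Longrightarrow> rmem s0 ''X'' (i + i) = xs ! i $ 0"
      "\<And>i. i < n \<Longrightarrow> rmem s0 ''X'' (i + i + 1) = xs ! i $ 1"
    using n by (auto simp: s0_def input_def simp flip: mult_2)
  have k0: "0 < k" using inst by (simp add: pareto_instance_def)
  \<comment> \<open>Uses n + 1 \<le> 2 * n, as n is positive.\<close>
  have "200 * (n + 1) * L \<le> 400 * n * L" using n(2) by (intro mult_right_mono) auto
  then have sort_time: "200 * (n + 1) * L + 20 + (620 * n * k + 420 * n + 240) + 1 \<le>
      400 * n * L + 620 * n * k + 420 * n + 270"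
    by linarith
  have "(400 * n + 220) * k \<le> 620 * n * k" using n(2) by (intro mult_right_mono) auto
  then have dp_time: "(400 * n + 220) * k + 20 + (300 * n + 120) + 1 \<le> 620 * n * k + 300 * n + 170"
    by linarith
  have "run plane_prog s0 (400 * n * L + 620 * n * k + 450 * n + 300)
    (\<lambda>s. correct_output xs k (read_output s))"
    unfolding plane_prog_def
  proof (rule run_Seq'[OF run_id_prog[OF s0(1)]])
    fix s1 assume s1: "rmem s1 = rmem s0 \<and> nframe {''i'', ''a''} s0 s1 \<and> perm_on n (nmem s1 ''a'')"
    have n1: "nmem s1 ''n'' 0 = n" and perm1: "perm_on n (nmem s1 ''a'')"
      using s1 s0 by (auto simp: nframe_def)
    show "run (Seq sort_prog (Seq fill_prog (Seq init_prog (Seq dp_prog (Seq greedy_prog output_prog)))))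
       s1 (400 * n * L + 620 * n * k + 420 * n + 270) (\<lambda>s. correct_output xs k (read_output s))"
    proof (rule run_Seq'[OF run_sort_prog[OF n1 L perm1]])
      fix s2 assume s2: "rmem s2 = rmem s1 \<and> nframe {''l'', ''i'', ''j'', ''t'', ''b'', ''a'', ''w''} s1 s2 \<and>
        perm_on n (nmem s2 ''a'') \<and>
        (\<forall>p q. p \<le> q \<longrightarrow> q < n \<longrightarrow> point_key s1 (nmem s2 ''a'' p) \<le> point_key s1 (nmem s2 ''a'' q))"
      define a where "a = nmem s2 ''a''"
      have n2: "nmem s2 ''n'' 0 = n" using s2 n1 by (simp add: nframe_def)
      have perm: "perm_on n a" using s2 by (simp add: a_def)
      then have a_less: "a p < n" if "p < n" for p using that by (auto simp: perm_on_def)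
      have sorted: "xs ! a p $ 0 \<le> xs ! a q $ 0" if "p \<le> q" "q < n" for p q
      proof -
        have "point_key s1 (a p) \<le> point_key s1 (a q)" using s2 that by (simp add: a_def)
        then show ?thesis using s1 that a_less by (simp add: point_key_def s0(4))
      qed
      show "run (Seq fill_prog (Seq init_prog (Seq dp_prog (Seq greedy_prog output_prog))))
        s2 (620 * n * k + 420 * n + 240) (\<lambda>s. correct_output xs k (read_output s))"
      proof (rule run_Seq'[OF run_fill_prog[OF n2]])
        fix s3 assume "nframe {''i''} s2 s3 \<and>
          (\<forall>p<n. rmem s3 ''x'' p = rmem s2 ''X'' (nmem s2 ''a'' p + nmem s2 ''a'' p) \<and>
            rmem s3 ''u'' p = - rmem s2 ''X'' (nmem s2 ''a'' p + nmem s2 ''a'' p + 1)) \<and>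
          (\<forall>a. a \<notin> {''x'', ''u''} \<longrightarrow> rmem s3 a = rmem s2 a)"
        then have fr3: "nframe {''i''} s2 s3" and
          pts: "\<And>p. p < n \<Longrightarrow> rmem s3 ''x'' p = xs ! a p $ 0"
            "\<And>p. p < n \<Longrightarrow> rmem s3 ''u'' p = - (xs ! a p $ 1)"
          using s2 s1 s0(4,5) a_less by (auto simp: a_def)
        have n3: "nmem s3 ''n'' 0 = n" using fr3 n2 by (simp add: nframe_def)
        interpret sorted_points n xs a k "rmem s3 ''x''" "rmem s3 ''u''"
          by unfold_locales (use inst dist n perm pts sorted in auto)
        show "run (Seq init_prog (Seq dp_prog (Seq greedy_prog output_prog)))
          s3 (620 * n * k + 360 * n + 210) (\<lambda>s. correct_output xs k (read_output s))"
        proof (rule run_Seq'[OF run_init_prog[OF n3, of "rmem s3 ''x''" "rmem s3 ''u''"]])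
          fix s4 assume "nframe {''i''} s3 s4 \<and> (\<forall>b\<le>n. rmem s4 ''G'' b = best 0 b) \<and>
            (\<forall>a. a \<noteq> ''G'' \<longrightarrow> rmem s4 a = rmem s3 a)"
          then have s4: "nframe {''i''} s3 s4" "\<And>b. b \<le> n \<Longrightarrow> rmem s4 ''G'' b = best 0 b"
              "rmem s4 ''x'' = rmem s3 ''x''" "rmem s4 ''u'' = rmem s3 ''u''"
            by auto
          have nk4: "nmem s4 ''n'' 0 = n" "nmem s4 ''k'' 0 = k"
            using s4 fr3 s2 s1 s0 by (auto simp: nframe_def)
          show "run (Seq dp_prog (Seq greedy_prog output_prog))
            s4 (620 * n * k + 300 * n + 170) (\<lambda>s. correct_output xs k (read_output s))"
          proof (rule run_Seq'[OF run_dp_prog[OF nk4 s4(3,4,2)]])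
            fix s5 assume "nframe {''i'', ''j'', ''m''} s4 s5 \<and>
              (\<forall>a. a \<notin> {''F'', ''G''} \<longrightarrow> rmem s5 a = rmem s4 a) \<and> rmem s5 ''G'' n = best k n"
            then have s5: "nframe {''i'', ''j'', ''m''} s4 s5" "rmem s5 ''G'' n = best k n"
                "rmem s5 ''x'' = rmem s3 ''x''" "rmem s5 ''u'' = rmem s3 ''u''"
              using s4 by auto
            have nk5: "nmem s5 ''n'' 0 = n" "nmem s5 ''k'' 0 = k" "nmem s5 ''a'' = a"
                "\<And>p. p < n \<Longrightarrow> nmem s5 ''z'' p = 0"
              using s5 s4 nk4 fr3 s2 s1 s0 by (auto simp: nframe_def a_def)
            show "run (Seq greedy_prog output_prog) s5 (300 * n + 120)
              (\<lambda>s. correct_output xs k (read_output s))"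
            proof (rule run_Seq'[OF run_greedy_prog[OF nk5(1,2) s5(3,4,2) best_le_range[OF k0] nk5(4)]])
              fix s6 assume s6: "nframe {''p'', ''q'', ''z'', ''rem''} s5 s6 \<and> rmem s6 = rmem s5 \<and>
                nmem s6 ''rem'' 0 + card (marked n s6) = k \<and>
                (\<forall>i<n. \<exists>p\<in>marked n s6. gap i p \<le> best k n)"
              have n6: "nmem s6 ''n'' 0 = n" "nmem s6 ''a'' = a"
                using s6 nk5 by (simp_all add: nframe_def)
              show "run output_prog s6 (100 * n + 30) (\<lambda>s. correct_output xs k (read_output s))"
              proof (rule run_mono[OF run_output_prog[OF n6(1) _ k]])
                fix s assume "\<exists>ps. read_output s = map (nmem s6 ''a'') ps \<and> distinct ps \<and>
                  length ps = k \<and> marked n s6 \<subseteq> set ps \<and> set ps \<subseteq> {..<n}"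
                then obtain ps where ps: "read_output s = map a ps" "distinct ps" "length ps = k"
                  "marked n s6 \<subseteq> set ps" "set ps \<subseteq> {..<n}" using n6 by auto
                show "correct_output xs k (read_output s)"
                  unfolding ps(1) by (rule correct_output_map[OF ps(2,3,5) k]) (use s6 ps(4) in blast)
              qed (use s6 in auto)
            qed auto
          qed (assumption, rule dp_time)
        qed simp_all
      qed simp_all
    qed (rule sort_time)
  qed simp
  then show ?thesis by (simp add: s0_def)
qed

text \<open>Unwritten cells are 0: after \<open>Skip\<close> the length 0 reports infeasibility, and
  for d < 2 setting the length to 1 reports position 0, the only alternative.\<close>

definition DC_prog :: com where
  "DC_prog = Cond (NLess (NVar ''n'') (NVar ''k'')) Skip
     (Cond (NLess (NVar ''d'') (NConst 2)) (NSet ''len'' (NConst 1)) plane_prog)"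

lemma run_DC_prog:
  assumes inst: "pareto_instance d A k" and "d \<le> 2" and "A \<noteq> {}" and xs: "distinct xs" "set xs = A"
    and n: "n = length xs" and L: "n \<le> 2 ^ L"
  shows "run DC_prog (input d k xs) (400 * n * L + 620 * n * k + 450 * n + 350)
    (\<lambda>s. correct_output xs k (read_output s))"
proof -
  let ?s = "input d k xs"
  have card: "card (set xs) = n" using n distinct_card[OF xs(1)] by simp
  have vars: "nmem ?s ''n'' 0 = n" "nmem ?s ''d'' 0 = d" "nmem ?s ''k'' 0 = k"
    by (simp_all add: input_def n)
  have k0: "0 < k" using inst by (simp add: pareto_instance_def)
  show ?thesis
    unfolding DC_prog_def
  proof (rule run_Cond[where T = "400 * n * L + 620 * n * k + 450 * n + 320"])
    assume "bval (NLess (NVar ''n'') (NVar ''k'')) ?s"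
    then have "correct_output xs k (read_output ?s)"
      using vars card by (simp add: correct_output_def) (simp add: input_def read_output_def)
    then show "run Skip ?s (400 * n * L + 620 * n * k + 450 * n + 320)
        (\<lambda>s. correct_output xs k (read_output s))"
      by (intro run_loop_free) simp_all
  next
    assume "\<not> bval (NLess (NVar ''n'') (NVar ''k'')) ?s"
    then have "k \<le> n" using vars by simp
    have "0 < n" using n xs \<open>A \<noteq> {}\<close> by auto
    show "run (Cond (NLess (NVar ''d'') (NConst 2)) (NSet ''len'' (NConst 1)) plane_prog) ?s
        (400 * n * L + 620 * n * k + 450 * n + 320) (\<lambda>s. correct_output xs k (read_output s))"
    proof (rule run_Cond[where T = "400 * n * L + 620 * n * k + 450 * n + 300"])
      assume "bval (NLess (NVar ''d'') (NConst 2)) ?s"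
      then have "d < 2" using vars by simp
      then have "n = 1" "k = 1"
        using pareto_card_le_1[OF inst] card xs \<open>0 < n\<close> \<open>k \<le> n\<close> k0 by auto
      then obtain y where y: "xs = [y]" using n by (auto simp: length_Suc_conv)
      have "read_output (nstore ''len'' 0 1 ?s) = [0]"
        by (simp add: read_output_def) (simp add: input_def)
      moreover have "optimal_DC {y} 1 {y}"
        unfolding optimal_DC_def is_arg_min_def
        by (auto simp: card_1_singleton_iff)
      ultimately have "correct_output xs k (read_output (nstore ''len'' 0 1 ?s))"
        using y \<open>k = 1\<close> by (simp add: correct_output_def)
      then show "run (NSet ''len'' (NConst 1)) ?s (400 * n * L + 620 * n * k + 450 * n + 300)
          (\<lambda>s. correct_output xs k (read_output s))"
        by (intro run_loop_free) simp_all
    next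
      assume "\<not> bval (NLess (NVar ''d'') (NConst 2)) ?s"
      then have "d = 2" using vars \<open>d \<le> 2\<close> by simp
      then show "run plane_prog ?s (400 * n * L + 620 * n * k + 450 * n + 300)
          (\<lambda>s. correct_output xs k (read_output s))"
        using run_plane_prog[OF _ xs(1) n \<open>0 < n\<close> \<open>k \<le> n\<close> L] inst xs(2) by simp
    qed simp
  qed simp
qed

theorem proposition7:
  "DC_solvable_in (\<lambda>d. d \<le> 2) (\<lambda>n k. real n * real k + real n * log 2 (real n))"
  unfolding DC_solvable_in_def
proof (rule exI[of _ DC_prog], rule exI[of _ "2000::real"], intro allI impI)
  fix d A k xs
  assume "d \<le> 2" and inst: "pareto_instance d A k" and "A \<noteq> {}" and xs: "distinct xs" "set xs = A"
  define n where "n = card A"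
  have n: "n = length xs" using distinct_card[OF xs(1)] xs(2) by (simp add: n_def)
  have "0 < n" "0 < k" using n xs \<open>A \<noteq> {}\<close> inst by (auto simp: pareto_instance_def)
  \<comment> \<open>The rounding adds at most one pass, hence a term linear in n.\<close>
  define L where "L = nat \<lceil>log 2 (real n)\<rceil>"
  have "0 \<le> log 2 (real n)" using \<open>0 < n\<close> by simp
  then have L: "log 2 (real n) \<le> real L" "real L \<le> log 2 (real n) + 1"
    unfolding L_def by linarith+
  have "real n = 2 powr log 2 (real n)" using \<open>0 < n\<close> by simp
  also have "\<dots> \<le> 2 powr real L" using L by simp
  also have "\<dots> = real (2 ^ L)" by (simp add: powr_realpow)
  finally have "n \<le> 2 ^ L" using of_nat_le_iff by blast
  from run_DC_prog[OF inst \<open>d \<le> 2\<close> \<open>A \<noteq> {}\<close> xs n this]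
  obtain t s where ts: "exec DC_prog (input d k xs) t s" "correct_output xs k (read_output s)"
    "t \<le> 400 * n * L + 620 * n * k + 450 * n + 350"
    unfolding run_def by blast
  have "real t \<le> real (400 * n * L + 620 * n * k + 450 * n + 350)"
    using ts(3) of_nat_le_iff by blast
  also have "\<dots> = 400 * (real n * real L) + 620 * (real n * real k) + 450 * real n + 350"
    by simp
  also have "\<dots> \<le> 400 * (real n * (log 2 (real n) + 1)) + 620 * (real n * real k) + 450 * real n + 350"
    using L by (intro add_right_mono mult_left_mono) auto
  also have "\<dots> = 400 * (real n * log 2 (real n)) + 620 * (real n * real k) + 850 * real n + 350"
    by (simp add: algebra_simps)
  also have "\<dots> \<le> 2000 * (real n * real k + real n * log 2 (real n))"
  proof -
    \<comment> \<open>Linear and constant terms are absorbed by n * k, because 1 \<le> n \<le> n *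
      k: the coefficients 620 + 850 + 350 stay below 2000.\<close>
    have linear: "400 * X + 620 * Y + 850 * Z + 350 \<le> 2000 * (Y + X)"
      if "Z \<le> Y" "1 \<le> Z" "0 \<le> X" for X Y Z :: real
      using that unfolding distrib_left by linarith
    have "real n * 1 \<le> real n * real k" using \<open>0 < k\<close> by (intro mult_left_mono) auto
    moreover have "0 \<le> real n * log 2 (real n)" using \<open>0 \<le> log 2 (real n)\<close> by simp
    ultimately show ?thesis
      using \<open>0 < n\<close> by (intro linear) simp_all
  qed
  finally show "\<exists>t s. exec DC_prog (input d k xs) t s \<and>
      real t \<le> 2000 * (real (card A) * real k + real (card A) * log 2 (real (card A))) \<and>
      correct_output xs k (read_output s)"
    using ts unfolding n_def by blast
qed

end
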